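(* Let $(K,\mu)$ be a strongly mixing Markov system on a compact metric space $\Sigma$. For any $0<\alpha\le1$ and $\xi\in\mathscr{H}_\alpha(X^-)$ there exist $C=C(\xi)>0$, $k=k(\xi)>0$ and $\varepsilon_0=\varepsilon_0(\xi)>0$ such that for all $0<\varepsilon<\varepsilon_0$ and $n\in\mathbb{N}$, $$\mathbb{P}_\mu\left[\left|\frac1n\sum_{j=0}^{n-1}\xi\circ T^j-\mathbb{E}_\mu(\xi)\right|>\varepsilon\right]\le C\,e^{-k\,\varepsilon^2\,n}.$$ Moreover, the constants $C$, $k$ and $\varepsilon_0$ depend only on $K$ and $\|\xi\|_\alpha$, and hence can be kept constant when $K$ is fixed and $\xi$ ranges over any bounded set in $\mathscr{H}_\alpha(X^-)$.
   Context: $\Sigma$ is a compact metric space with Borel $\sigma$-field $\mathscr{F}$. A Markov kernel is $K:\Sigma\times\mathscr{F}\to[0,1]$ with $K(x,\cdot)$ a probability measure for every $x$ and $K(\cdot,A)$ measurable for every $A$; $K^1=K$, $K^{n+1}(x,A)=\int_\Sigma K^n(y,A)K(x,dy)$. A probability $\mu$ is $K$-stationary if $\mu(A)=\int K(x,A)\mu(dx)$ for all $A$; a Markov system is a pair $(K,\mu)$ with $\mu$ $K$-stationary. It is strongly mixing if there are $C>0$, $0<\rho<1$ with $|\int f(y)K^n(x,dy)-\int f\,d\mu|\le C\rho^n\|f\|_\infty$ for all bounded measurable $f:\Sigma\to\mathbb{C}$, $x\in\Sigma$, $n\in\mathbb{N}$ ($\|\cdot\|_\infty$ is the sup norm). $X=\Sigma^{\mathbb{Z}}$,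 $T(x_n)_n=(x_{n+1})_n$ is the shift, $\mathbb{P}_\mu$ is the $T$-invariant Borel probability on $X$ which is the law of the stationary Markov chain with kernel $K$ and marginal $\mu$, and $\mathbb{E}_\mu(\xi)=\int_X\xi\,d\mathbb{P}_\mu$. On $X$ consider the distance $\tilde d(x,x')=2^{-\inf\{|k|:k\in\mathbb{Z},\,x_k\ne x'_k\}}$. For bounded measurable $f:X\to\mathbb{C}$, $k\in\mathbb{N}=\{0,1,\dots\}$ and $\alpha>0$ let $v_k(f)=\sup\{|f(x)-f(y)|:\tilde d(x,y)\le2^{-k}\}$, $v_\alpha(f)=\sup_{k\in\mathbb{N}}2^{\alpha k}v_k(f)$, $\|f\|_\alpha=\|f\|_\infty+v_\alpha(f)$, and $\mathscr{H}_\alpha(X)=\{f \text{ bounded measurable}: v_\alpha(f)<\infty\}$. A function $f:X\to\mathbb{C}$ is future independent if $f(x)=f(y)$ whenever $x_k=y_k$ for all $k\le0$. $\mathscr{H}_\alpha(X^-)$ is the set of future independent $f\in\mathscr{H}_\alpha(X)$. *)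

theory Defs
  imports "HOL-Probability.Probability"
begin

text \<open>Throughout, the space \<open>\<Sigma>\<close> is a type \<open>'a\<close> of class \<^class>\<open>metric_space\<close>; its compactness is a hypothesis
  of the theorem. Bi-infinite sequences have type \<open>int \<Rightarrow> 'a\<close>, and \<open>borel\<close> on that type
  is the Borel \<open>\<sigma>\<close>-field of the product topology (not of the finer topology induced by
  \<open>seq_dist\<close> below).\<close>

subsection \<open>Markov systems\<close>

text \<open>The \<open>\<sigma>\<close>-field of \<open>prob_algebra borel\<close> is generated by the evaluations
  \<open>\<nu> \<mapsto> \<nu>(A)\<close>, so measurability into it means that every \<open>K x\<close> is a Borel
  probability measure and every \<open>x \<mapsto> K x A\<close> is measurable.\<close>

definition markov_kernel :: "('a::metric_space \<Rightarrow> 'a measure) \<Rightarrow> bool" where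
  "markov_kernel K \<longleftrightarrow> K \<in> borel \<rightarrow>\<^sub>M prob_algebra borel"

text \<open>For a Markov kernel, \<open>bind\<close> gives \<open>K\<^sup>n\<^sup>+\<^sup>1(x,A) = \<integral> K\<^sup>n(y,A) K(x,dy)\<close>; the Dirac kernel at
  \<open>n = 0\<close> makes \<open>K\<^sup>1 = K\<close>.\<close>

primrec kernel_pow :: "('a::metric_space \<Rightarrow> 'a measure) \<Rightarrow> nat \<Rightarrow> 'a \<Rightarrow> 'a measure" where
  "kernel_pow K 0 x = return borel x"
| "kernel_pow K (Suc n) x = K x \<bind> kernel_pow K n"

definition stationary :: "('a::metric_space \<Rightarrow> 'a measure) \<Rightarrow> 'a measure \<Rightarrow> bool" where
  "stationary K \<mu> \<longleftrightarrow> (\<forall>A\<in>sets borel. emeasure \<mu> A = (\<integral>\<^sup>+x. emeasure (K x) A \<partial>\<mu>))"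

definition markov_system :: "('a::metric_space \<Rightarrow> 'a measure) \<Rightarrow> 'a measure \<Rightarrow> bool" where
  "markov_system K \<mu> \<longleftrightarrow>
     markov_kernel K \<and> prob_space \<mu> \<and> sets \<mu> = sets borel \<and> stationary K \<mu>"

text \<open>Only meaningful for bounded \<open>f\<close>, since \<open>SUP\<close> is the real-valued supremum.\<close>

definition sup_norm :: "('b \<Rightarrow> complex) \<Rightarrow> real" where
  "sup_norm f = (SUP x. cmod (f x))"

definition strongly_mixing :: "('a::metric_space \<Rightarrow> 'a measure) \<Rightarrow> 'a measure \<Rightarrow> bool" where
  "strongly_mixing K \<mu> \<longleftrightarrow>
     (\<exists>C>0. \<exists>\<rho>. 0 < \<rho> \<and> \<rho> < 1 \<and>
        (\<forall>f :: 'a \<Rightarrow> complex. f \<in> borel_measurable borel \<longrightarrow> bounded (range f) \<longrightarrow>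
           (\<forall>x. \<forall>n\<ge>1. cmod ((\<integral>y. f y \<partial>kernel_pow K n x) - (\<integral>y. f y \<partial>\<mu>)) \<le> C * \<rho> ^ n * sup_norm f)))"

subsection \<open>The law of the stationary chain\<close>

text \<open>\<open>path_prob K [A\<^sub>1,\<dots>,A\<^sub>n] x\<close> is
  \<open>\<integral>\<^sub>A\<^sub>1 K(x,dx\<^sub>1) \<integral>\<^sub>A\<^sub>2 K(x\<^sub>1,dx\<^sub>2) \<dots> \<integral>\<^sub>A\<^sub>n K(x\<^sub>n\<^sub>-\<^sub>1,dx\<^sub>n)\<close>, the probability that the chain started at
  \<open>x\<close> next visits \<open>A\<^sub>1, \<dots>, A\<^sub>n\<close> in this order.\<close>

primrec path_prob :: "('a::metric_space \<Rightarrow> 'a measure) \<Rightarrow> 'a set list \<Rightarrow> 'a \<Rightarrow> ennreal" where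
  "path_prob K [] x = 1"
| "path_prob K (A # As) x = (\<integral>\<^sup>+y\<in>A. path_prob K As y \<partial>K x)"

text \<open>The measure \<open>\<P>\<^sub>\<mu>\<close> is characterised by its finite-dimensional distributions: the block of
  coordinates starting at any time \<open>m\<close> has initial law \<open>\<mu>\<close> and transitions \<open>K\<close>. As the
  formula does not depend on \<open>m\<close>, it contains shift invariance.\<close>

definition markov_chain_law ::
    "('a::metric_space \<Rightarrow> 'a measure) \<Rightarrow> 'a measure \<Rightarrow> (int \<Rightarrow> 'a) measure \<Rightarrow> bool" where
  "markov_chain_law K \<mu> P \<longleftrightarrow>
     prob_space P \<and> sets P = sets borel \<and>
     (\<forall>(m::int) A As. set (A # As) \<subseteq> sets borel \<longrightarrow>
        emeasure P {x. \<forall>i<length (A # As). x (m + int i) \<in> (A # As) ! i}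
          = (\<integral>\<^sup>+y\<in>A. path_prob K As y \<partial>\<mu>))"

definition shift :: "(int \<Rightarrow> 'a) \<Rightarrow> (int \<Rightarrow> 'a)" where
  "shift x = (\<lambda>n. x (n + 1))"

subsection \<open>Hoelder observables\<close>

text \<open>The first case is the convention \<open>inf \<emptyset> = \<infinity>\<close>.\<close>

definition seq_dist :: "(int \<Rightarrow> 'a) \<Rightarrow> (int \<Rightarrow> 'a) \<Rightarrow> real" where
  "seq_dist x y = (if x = y then 0 else (1/2) ^ (Inf {nat \<bar>k\<bar> |k. x k \<noteq> y k}))"

text \<open>The suprema below are real-valued; \<open>variation f k\<close> is meaningful for bounded \<open>f\<close>, and
  \<open>v\<^sub>\<alpha>(f) < \<infinity>\<close> is expressed by \<open>bdd_above\<close> in \<open>hoelder_space\<close>.\<close>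

definition variation :: "((int \<Rightarrow> 'a) \<Rightarrow> complex) \<Rightarrow> nat \<Rightarrow> real" where
  "variation f k = (SUP (x, y) \<in> {(x, y). seq_dist x y \<le> (1/2) ^ k}. cmod (f x - f y))"

definition hoelder_seminorm :: "real \<Rightarrow> ((int \<Rightarrow> 'a) \<Rightarrow> complex) \<Rightarrow> real" where
  "hoelder_seminorm \<alpha> f = (SUP k::nat. 2 powr (\<alpha> * real k) * variation f k)"

definition hoelder_norm :: "real \<Rightarrow> ((int \<Rightarrow> 'a) \<Rightarrow> complex) \<Rightarrow> real" where
  "hoelder_norm \<alpha> f = sup_norm f + hoelder_seminorm \<alpha> f"

definition hoelder_space :: "real \<Rightarrow> ((int \<Rightarrow> 'a::metric_space) \<Rightarrow> complex) set" where
  "hoelder_space \<alpha> =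
     {f. f \<in> borel_measurable borel \<and> bounded (range f) \<and>
         bdd_above (range (\<lambda>k::nat. 2 powr (\<alpha> * real k) * variation f k))}"

definition future_independent :: "((int \<Rightarrow> 'a) \<Rightarrow> complex) \<Rightarrow> bool" where
  "future_independent f \<longleftrightarrow> (\<forall>x y. (\<forall>k\<le>0. x k = y k) \<longrightarrow> f x = f y)"

definition hoelder_space_past :: "real \<Rightarrow> ((int \<Rightarrow> 'a::metric_space) \<Rightarrow> complex) set" where
  "hoelder_space_past \<alpha> = {f \<in> hoelder_space \<alpha>. future_independent f}"

end

theory Submission
  imports Defs
begin

text \<open>
  Put \<open>c\<close> for the mean of the observable. A future independent observable is a function \<open>f\<close> of the
  past \<open>u = (x\<^sub>0, x\<^sub>-\<^sub>1, \<dots>)\<close>, and the past is itself a Markov chain: one step draws a new state from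
  \<open>K (u 0)\<close> and puts it in front (\<open>extend\<close>). Let \<open>Q\<close> be the Markov operator of this chain. The law of
  the past under \<open>\<P>\<^sub>\<mu>\<close> is stationary for it (\<open>past_law_stationary\<close>).

  The chain of pasts carries its whole history along, so in general it does not mix uniformly over
  all bounded functions as \<open>K\<close> does, but \<open>Q\<^sup>n f\<close>
  converges to \<open>c\<close> uniformly and exponentially fast for Hoelder \<open>f\<close>: half of the steps push the
  initial past, except its newest state, so far back that \<open>f\<close> barely depends on it, and the other
  half uses the mixing of \<open>K\<close> to forget that one state (\<open>markov_op_extend_oscillation\<close>).
  The rates involve only \<open>K\<close>, \<open>\<alpha>\<close> and a bound on the Hoelder norm.

  Exponential convergence bounds the partial sums \<open>\<psi> = (\<Sum>j<N. Q\<^sup>j f - c)\<close> by a constant \<open>M\<close>, and they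
  solve \<open>\<psi> - Q \<psi> = f - Q\<^sup>N f\<close>. For large \<open>N\<close> the right-hand side is almost \<open>f - c\<close>, so the centred sum of \<open>f\<close>
  along the path is a bounded error plus a sum of increments of the form \<open>\<psi>(new) - (Q \<psi>)(old)\<close>.
  These are bounded martingale differences, and Hoeffding's lemma in each step bounds the
  exponential moment by \<open>exp (n * t\<^sup>2 * M\<^sup>2 / 2)\<close> (\<open>martingale_exp_moment_bound\<close>). Exponential
  Chebyshev with the best \<open>t\<close> gives \<open>exp (- n * \<epsilon>\<^sup>2 / (2 * M\<^sup>2))\<close> (\<open>birkhoff_sum_deviation\<close>); a complex
  observable is treated in the four directions \<open>1, -1, \<i>, -\<i>\<close>.
\<close>

section \<open>Markov operators\<close>

definition markov_op :: "('b \<Rightarrow> 'b measure) \<Rightarrow> ('b \<Rightarrow> real) \<Rightarrow> 'b \<Rightarrow> real" where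
  "markov_op L f x = (\<integral>y. f y \<partial>L x)"

lemma markov_op_measurable:
  assumes "L \<in> S \<rightarrow>\<^sub>M prob_algebra S" "f \<in> borel_measurable S"
  shows "markov_op L f \<in> borel_measurable S"
  unfolding markov_op_def
  by (rule measurable_compose[OF measurable_prob_algebraD[OF assms(1)]
        integral_measurable_subprob_algebra[OF assms(2)]])

lemma kernel_prob_space:
  assumes "L \<in> S \<rightarrow>\<^sub>M prob_algebra S" "space S = UNIV"
  shows "prob_space (L x)" "sets (L x) = sets S"
  using measurable_space[OF assms(1), of x] assms(2) by (auto simp: space_prob_algebra)

lemma (in prob_space) abs_integral_diff_le:
  fixes f g :: "'a \<Rightarrow> real"
  assumes "f \<in> borel_measurable M" "g \<in> borel_measurable M"
    "\<And>x. \<bar>f x\<bar> \<le> B" "\<And>x. \<bar>g x\<bar> \<le> B'" "\<And>x. \<bar>f x - g x\<bar> \<le> w"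
  shows "\<bar>(\<integral>x. f x \<partial>M) - (\<integral>x. g x \<partial>M)\<bar> \<le> w"
proof -
  have f: "integrable M f" by (rule integrable_const_bound[of _ B]) (use assms in auto)
  have g: "integrable M g" by (rule integrable_const_bound[of _ B']) (use assms in auto)
  have "(\<integral>x. f x \<partial>M) - (\<integral>x. g x \<partial>M) = (\<integral>x. f x - g x \<partial>M)"
    using f g by simp
  also have "\<bar>\<dots>\<bar> \<le> (\<integral>x. \<bar>f x - g x\<bar> \<partial>M)"
    by (rule integral_abs_bound)
  also have "\<dots> \<le> (\<integral>x. w \<partial>M)"
    by (rule integral_mono) (use f g assms in auto)
  also have "\<dots> = w" by (simp add: prob_space)
  finally show ?thesis .
qed

lemma markov_op_diff_le:
  assumes L: "L \<in> S \<rightarrow>\<^sub>M prob_algebra S" "space S = UNIV"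
    and "f \<in> borel_measurable S" "g \<in> borel_measurable S"
    "\<And>x. \<bar>f x\<bar> \<le> B" "\<And>x. \<bar>g x\<bar> \<le> B'" "\<And>x. \<bar>f x - g x\<bar> \<le> w"
  shows "\<bar>markov_op L f x - markov_op L g x\<bar> \<le> w"
proof -
  interpret prob_space "L x" by (rule kernel_prob_space[OF L])
  show ?thesis unfolding markov_op_def
    by (rule abs_integral_diff_le[of _ _ B B'])
       (use assms in \<open>simp_all add: measurable_cong_sets[OF kernel_prob_space(2)[OF L] refl]\<close>)
qed

lemma markov_op_bounded:
  assumes "L \<in> S \<rightarrow>\<^sub>M prob_algebra S" "space S = UNIV"
    "f \<in> borel_measurable S" "\<And>x. \<bar>f x\<bar> \<le> B"
  shows "\<bar>markov_op L f x\<bar> \<le> B"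
  using markov_op_diff_le[OF assms(1-3), of "\<lambda>_. 0" B 0 B x] assms(4)
  by (simp add: markov_op_def)

lemma markov_op_funpow_measurable_bounded:
  assumes "L \<in> S \<rightarrow>\<^sub>M prob_algebra S" "space S = UNIV"
    "f \<in> borel_measurable S" "\<And>x. \<bar>f x\<bar> \<le> B"
  shows "(markov_op L ^^ n) f \<in> borel_measurable S" "\<bar>(markov_op L ^^ n) f x\<bar> \<le> B"
proof (induction n arbitrary: x)
  case (Suc n)
  { case 1 show ?case using Suc(1) assms(1) by (simp add: markov_op_measurable) }
  { case 2 show ?case using Suc assms by (simp add: markov_op_bounded) }
qed (use assms in auto)

lemma markov_op_funpow_diff_le:
  assumes L: "L \<in> S \<rightarrow>\<^sub>M prob_algebra S" "space S = UNIV"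
    and fg: "f \<in> borel_measurable S" "g \<in> borel_measurable S"
    "\<And>x. \<bar>f x\<bar> \<le> B" "\<And>x. \<bar>g x\<bar> \<le> B'" and "\<And>x. \<bar>f x - g x\<bar> \<le> w"
  shows "\<bar>(markov_op L ^^ n) f x - (markov_op L ^^ n) g x\<bar> \<le> w"
proof (induction n arbitrary: x)
  case (Suc n)
  show ?case
    using markov_op_diff_le[OF L markov_op_funpow_measurable_bounded(1)[OF L fg(1,3)] markov_op_funpow_measurable_bounded(1)[OF L fg(2,4)]
        markov_op_funpow_measurable_bounded(2)[OF L fg(1,3)] markov_op_funpow_measurable_bounded(2)[OF L fg(2,4)] Suc.IH]
    by simp
qed (use assms in auto)

lemma integral_markov_op_stationary:
  assumes L: "L \<in> S \<rightarrow>\<^sub>M prob_algebra S" "space S = UNIV"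
    and nu: "prob_space \<nu>" "sets \<nu> = sets S" "\<nu> \<bind> L = \<nu>"
    and f: "f \<in> borel_measurable S" "\<And>x. \<bar>f x\<bar> \<le> B"
  shows "(\<integral>x. (markov_op L ^^ n) f x \<partial>\<nu>) = (\<integral>x. f x \<partial>\<nu>)"
proof (induction n)
  case (Suc n)
  interpret prob_space \<nu> by fact
  let ?g = "(markov_op L ^^ n) f"
  have Lnu: "L \<in> \<nu> \<rightarrow>\<^sub>M subprob_algebra S"
    using measurable_prob_algebraD[OF L(1)] by (simp add: measurable_cong_sets[OF nu(2) refl])
  have "(\<integral>x. ?g x \<partial>(\<nu> \<bind> L)) = (\<integral>x. markov_op L ?g x \<partial>\<nu>)"
    unfolding markov_op_def[of L ?g]
  proof (rule integral_bind[where N = L and K = S and B = B and B' = 1])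
    show "?g \<in> borel_measurable S" using markov_op_funpow_measurable_bounded(1)[OF L f] .
    show "AE x in \<nu>. emeasure (L x) (space (L x)) \<le> ennreal 1"
      by (simp add: prob_space.emeasure_space_1[OF kernel_prob_space(1)[OF L]])
  qed (use markov_op_funpow_measurable_bounded(2)[OF L f] Lnu finite_measure_axioms in auto)
  then show ?case using Suc by (simp add: nu(3))
qed simp

section \<open>Deviations of sums along a path that remembers its past\<close>

text \<open>Under \<open>L u\<close> the tail map \<open>D\<close> returns \<open>u\<close>, so a point \<open>v\<close> is a path whose history is
  \<open>D v, D (D v), \<dots>\<close>, and \<open>\<psi> v - markov_op L \<psi> (D v)\<close> is the increment of \<open>\<psi>\<close> in the newest step,
  minus its conditional mean. These are the martingale differences, without any filtration or
  conditional expectation: integrating over the newest step with \<open>u = D v\<close> held fixed leaves the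
  earlier terms untouched and costs one factor from Hoeffding's lemma (range of length \<open>2 * M\<close>),
  and \<open>\<nu> \<bind> L = \<nu>\<close> says that the history \<open>u\<close> again has law \<open>\<nu>\<close>.\<close>

lemma martingale_exp_moment_bound:
  fixes \<psi> :: "'b \<Rightarrow> real"
  assumes L: "L \<in> S \<rightarrow>\<^sub>M prob_algebra S" "space S = UNIV"
    and nu: "sets \<nu> = sets S" "prob_space \<nu>" "\<nu> \<bind> L = \<nu>"
    and D[measurable]: "D \<in> S \<rightarrow>\<^sub>M S" and D': "\<And>u. AE v in L u. D v = u"
    and psi[measurable]: "\<psi> \<in> borel_measurable S" and psi_le: "\<And>u. \<bar>\<psi> u\<bar> \<le> M"
    and t: "0 < t"
  shows "(\<integral>\<^sup>+v. ennreal (exp (t * (\<Sum>i<n. \<psi> ((D ^^ i) v) - markov_op L \<psi> ((D ^^ Suc i) v)))) \<partial>\<nu>)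
          \<le> ennreal (exp (t\<^sup>2 * M\<^sup>2 / 2)) ^ n"
proof (induction n)
  case 0
  show ?case using prob_space.emeasure_space_1[OF nu(2)] by simp
next
  case (Suc n)
  define Z where "Z v = \<psi> v - markov_op L \<psi> (D v)" for v
  have [measurable]: "markov_op L \<psi> \<in> borel_measurable S"
    by (rule markov_op_measurable[OF L(1) psi])
  have Zm[measurable]: "Z \<in> borel_measurable S" unfolding Z_def by measurable
  have Dm[measurable]: "(D ^^ i) \<in> S \<rightarrow>\<^sub>M S" for i by (rule measurable_compose_n[OF D])
  define H where "H n v = ennreal (exp (t * (\<Sum>i<n. Z ((D ^^ i) v))))" for n v
  have H[measurable]: "H n \<in> borel_measurable S" for n unfolding H_def by measurable
  have Lnu: "L \<in> \<nu> \<rightarrow>\<^sub>M subprob_algebra S"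
    using measurable_prob_algebraD[OF L(1)] by (simp add: measurable_cong_sets[OF nu(1) refl])
  have step: "(\<integral>\<^sup>+v. H (Suc n) v \<partial>L u) \<le> ennreal (exp (t\<^sup>2 * M\<^sup>2 / 2)) * H n u" for u
  proof -
    interpret prob_space "L u" by (rule kernel_prob_space[OF L])
    have ms: "measurable (L u) borel = measurable S borel"
      by (rule measurable_cong_sets[OF kernel_prob_space(2)[OF L] refl])
    interpret interval_bounded_random_variable "L u" \<psi> "- M" M
      by unfold_locales (use psi psi_le in \<open>auto simp: ms abs_le_iff minus_le_iff\<close>)
    have "H (Suc n) v = H n u * ennreal (exp (t * (\<psi> v - expectation \<psi>)))" if "D v = u" for v
    proof -
      have "(\<Sum>i<Suc n. Z ((D ^^ i) v)) = Z v + (\<Sum>i<n. Z ((D ^^ i) u))"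
        by (subst sum.lessThan_Suc_shift) (simp add: funpow_swap1 that)
      then show ?thesis
        unfolding H_def using that
        by (simp add: Z_def markov_op_def distrib_left exp_add flip: ennreal_mult')
    qed
    then have "(\<integral>\<^sup>+v. H (Suc n) v \<partial>L u)
        = (\<integral>\<^sup>+v. H n u * ennreal (exp (t * (\<psi> v - expectation \<psi>))) \<partial>L u)"
      by (intro nn_integral_cong_AE eventually_mono[OF D']) auto
    also have "\<dots> = H n u * (\<integral>\<^sup>+v. ennreal (exp (t * (\<psi> v - expectation \<psi>))) \<partial>L u)"
      by (rule nn_integral_cmult) (simp add: ms)
    also have "\<dots> \<le> H n u * ennreal (exp (t\<^sup>2 * M\<^sup>2 / 2))"
      using Hoeffdings_lemma_nn_integral[OF t]
      by (intro mult_left_mono) (simp_all add: power_mult_distrib mult.commute flip: mult_2)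
    finally show ?thesis by (simp add: mult.commute)
  qed
  have "(\<integral>\<^sup>+v. H (Suc n) v \<partial>\<nu>) = (\<integral>\<^sup>+v. H (Suc n) v \<partial>(\<nu> \<bind> L))"
    by (simp add: nu)
  also have "\<dots> = (\<integral>\<^sup>+u. \<integral>\<^sup>+v. H (Suc n) v \<partial>L u \<partial>\<nu>)"
    by (rule nn_integral_bind[OF H Lnu])
  also have "\<dots> \<le> (\<integral>\<^sup>+u. ennreal (exp (t\<^sup>2 * M\<^sup>2 / 2)) * H n u \<partial>\<nu>)"
    by (intro nn_integral_mono step)
  also have "\<dots> = ennreal (exp (t\<^sup>2 * M\<^sup>2 / 2)) * (\<integral>\<^sup>+u. H n u \<partial>\<nu>)"
    by (rule nn_integral_cmult) (simp add: measurable_cong_sets[OF nu(1) refl])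
  also have "\<dots> \<le> ennreal (exp (t\<^sup>2 * M\<^sup>2 / 2)) * ennreal (exp (t\<^sup>2 * M\<^sup>2 / 2)) ^ n"
    using Suc.IH unfolding H_def Z_def by (intro mult_left_mono) simp_all
  finally show ?case unfolding H_def Z_def by simp
qed

text \<open>Gordin's method. With \<open>\<psi> = (\<Sum>j<N. Q\<^sup>j f - c)\<close> the Poisson equation \<open>\<psi> - Q \<psi> = f - Q\<^sup>N f\<close> holds, and
  \<open>\<bar>\<psi>\<bar> \<le> M\<close> whatever \<open>N\<close> is. Shifting \<open>Q \<psi>\<close> by one step turns the sum of \<open>\<psi> - Q \<psi>\<close> along the path
  into the sum of martingale differences, up to two boundary terms. Stopping the series at a
  finite \<open>N\<close>, chosen so that \<open>Q\<^sup>N f\<close> is within \<open>1 / n\<close> of \<open>c\<close>, costs at most \<open>1\<close> in the whole sum and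
  keeps infinite series of functions out of the argument.\<close>

lemma birkhoff_sum_deviation:
  fixes f :: "'b \<Rightarrow> real"
  assumes L: "L \<in> S \<rightarrow>\<^sub>M prob_algebra S" "space S = UNIV"
    and nu: "sets \<nu> = sets S" "prob_space \<nu>" "\<nu> \<bind> L = \<nu>"
    and D[measurable]: "D \<in> S \<rightarrow>\<^sub>M S" and D': "\<And>u. AE v in L u. D v = u"
    and f[measurable]: "f \<in> borel_measurable S" and fB: "\<And>u. \<bar>f u\<bar> \<le> B"
    and delta: "\<And>n u. \<bar>(markov_op L ^^ n) f u - c\<bar> \<le> \<delta> n" "\<And>N. (\<Sum>n<N. \<delta> n) \<le> M" "\<delta> \<longlonglongrightarrow> 0"
    and M: "1 \<le> M" and eps: "0 < \<epsilon>" "\<epsilon> < 1"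
  shows "measure \<nu> {u. (\<Sum>i<n. f ((D ^^ i) u) - c) > real n * \<epsilon>} \<le> exp 3 * exp (- (1 / (2 * M\<^sup>2)) * \<epsilon>\<^sup>2 * real n)"
proof -
  interpret prob_space \<nu> by fact
  have sp: "space \<nu> = UNIV" using nu(1) L(2) sets_eq_imp_space_eq by blast
  have ms: "measurable \<nu> borel = measurable S borel"
    by (rule measurable_cong_sets[OF nu(1) refl])
  let ?Q = "markov_op L"
  have pm[measurable]: "(?Q ^^ j) f \<in> borel_measurable S" for j
    by (rule markov_op_funpow_measurable_bounded[OF L f fB])
  have pb: "\<bar>(?Q ^^ j) f u\<bar> \<le> B" for j u
    by (rule markov_op_funpow_measurable_bounded[OF L f fB])
  have Dm[measurable]: "(D ^^ i) \<in> S \<rightarrow>\<^sub>M S" for i by (rule measurable_compose_n[OF D])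
  obtain N where N: "real n * \<delta> N \<le> 1"
  proof -
    have "(\<lambda>N. real n * \<delta> N) \<longlonglongrightarrow> real n * 0" by (intro tendsto_intros delta)
    then have "\<forall>\<^sub>F N in sequentially. real n * \<delta> N < 1" by (intro order_tendstoD) auto
    then show ?thesis using that unfolding eventually_sequentially by (meson le_refl less_imp_le)
  qed
  define \<psi> where "\<psi> u = (\<Sum>j<N. (?Q ^^ j) f u - c)" for u
  have psim[measurable]: "\<psi> \<in> borel_measurable S" unfolding \<psi>_def by measurable
  have psib: "\<bar>\<psi> u\<bar> \<le> M" for u
  proof -
    have "\<bar>\<psi> u\<bar> \<le> (\<Sum>j<N. \<bar>(?Q ^^ j) f u - c\<bar>)" unfolding \<psi>_def by (rule sum_abs)
    also have "\<dots> \<le> (\<Sum>j<N. \<delta> j)" by (intro sum_mono delta)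
    finally show ?thesis using delta(2)[of N] by simp
  qed
  have Qpsib: "\<bar>?Q \<psi> u\<bar> \<le> M" for u by (rule markov_op_bounded[OF L psim psib])
  have poisson: "\<psi> u - ?Q \<psi> u = f u - (?Q ^^ N) f u" for u
  proof -
    interpret Lu: prob_space "L u" by (rule kernel_prob_space[OF L])
    have "integrable (L u) ((?Q ^^ j) f)" for j
      by (rule Lu.integrable_const_bound[of _ B])
         (use pb pm in \<open>auto simp: measurable_cong_sets[OF kernel_prob_space(2)[OF L] refl]\<close>)
    then have "?Q \<psi> u = (\<Sum>j<N. (\<integral>v. (?Q ^^ j) f v \<partial>L u) - c)"
      unfolding markov_op_def[of L \<psi>] \<psi>_def
      by (simp add: Lu.prob_space)
    also have "\<dots> = (\<Sum>j<N. (?Q ^^ Suc j) f u - c)" by (simp add: markov_op_def)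
    finally have "\<psi> u - ?Q \<psi> u = (\<Sum>j<N. (?Q ^^ j) f u - (?Q ^^ Suc j) f u)"
      unfolding \<psi>_def sum_subtractf by simp
    also have "\<dots> = f u - (?Q ^^ N) f u"
      using sum_lessThan_telescope'[of "\<lambda>j. (?Q ^^ j) f u" N] by simp
    finally show ?thesis .
  qed
  define W where "W u = (\<Sum>i<n. \<psi> ((D ^^ i) u) - ?Q \<psi> ((D ^^ Suc i) u))" for u
  have Qpsim[measurable]: "?Q \<psi> \<in> borel_measurable S" by (rule markov_op_measurable[OF L(1) psim])
  have Wm[measurable]: "W \<in> borel_measurable S" unfolding W_def by measurable
  have W: "(\<Sum>i<n. f ((D ^^ i) u) - c) \<le> W u + (2 * M + 1)" for u
  proof -
    have "f v - c \<le> \<psi> v - ?Q \<psi> v + \<delta> N" for v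
      using poisson[of v] delta(1)[of N v] by linarith
    then have "(\<Sum>i<n. f ((D ^^ i) u) - c) \<le> (\<Sum>i<n. (\<psi> ((D ^^ i) u) - ?Q \<psi> ((D ^^ i) u)) + \<delta> N)"
      by (intro sum_mono)
    also have "\<dots> = (\<Sum>i<n. \<psi> ((D ^^ i) u) - ?Q \<psi> ((D ^^ i) u)) + real n * \<delta> N"
      by (simp add: sum.distrib)
    also have "(\<Sum>i<n. \<psi> ((D ^^ i) u) - ?Q \<psi> ((D ^^ i) u))
       = W u + (\<Sum>i<n. ?Q \<psi> ((D ^^ Suc i) u) - ?Q \<psi> ((D ^^ i) u))"
      unfolding W_def by (simp add: sum_subtractf)
    also have "(\<Sum>i<n. ?Q \<psi> ((D ^^ Suc i) u) - ?Q \<psi> ((D ^^ i) u)) = ?Q \<psi> ((D ^^ n) u) - ?Q \<psi> u"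
      using sum_lessThan_telescope[of "\<lambda>i. ?Q \<psi> ((D ^^ i) u)" n] by simp
    finally show ?thesis using Qpsib[of "(D ^^ n) u"] Qpsib[of u] N by linarith
  qed
  \<comment> \<open>the minimiser of the exponent \<open>- t * n * \<epsilon> + n * t\<^sup>2 * M\<^sup>2 / 2\<close>\<close>
  define t where "t = \<epsilon> / M\<^sup>2"
  have t: "0 < t" unfolding t_def using M eps by simp
  define E where "E = {u. (\<Sum>i<n. f ((D ^^ i) u) - c) > real n * \<epsilon>}"
  have "E = {u \<in> space S. (\<Sum>i<n. f ((D ^^ i) u) - c) > real n * \<epsilon>}" unfolding E_def L(2) by simp
  also have "\<dots> \<in> sets S" by measurable
  finally have E: "E \<in> sets \<nu>" by (simp add: nu(1))
  let ?a = "exp (t * (2 * M + 1 - real n * \<epsilon>))"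
  have "emeasure \<nu> E = (\<integral>\<^sup>+u. indicator E u \<partial>\<nu>)" using E by simp
  also have "\<dots> \<le> (\<integral>\<^sup>+u. ennreal ?a * ennreal (exp (t * W u)) \<partial>\<nu>)"
  proof (rule nn_integral_mono)
    fix u
    show "indicator E u \<le> ennreal ?a * ennreal (exp (t * W u))"
    proof (cases "u \<in> E")
      case True
      then have "0 \<le> t * (2 * M + 1 - real n * \<epsilon> + W u)"
        using t W[of u] by (intro mult_nonneg_nonneg) (auto simp: E_def)
      then have "1 \<le> ?a * exp (t * W u)"
        by (subst exp_add[symmetric]) (simp add: algebra_simps)
      then have "ennreal 1 \<le> ennreal (?a * exp (t * W u))" by (rule ennreal_leI)
      then show ?thesis using True by (simp add: ennreal_mult)
    qed simp
  qed
  also have "\<dots> = ennreal ?a * (\<integral>\<^sup>+u. ennreal (exp (t * W u)) \<partial>\<nu>)"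
    by (rule nn_integral_cmult) (simp add: ms)
  also have "\<dots> \<le> ennreal ?a * ennreal (exp (t\<^sup>2 * M\<^sup>2 / 2)) ^ n"
    unfolding W_def
    by (intro mult_left_mono martingale_exp_moment_bound[OF L nu D D' psim psib t]) simp
  also have "\<dots> = ennreal (?a * exp (t\<^sup>2 * M\<^sup>2 / 2) ^ n)"
    by (simp add: ennreal_mult ennreal_power)
  finally have "measure \<nu> E \<le> ?a * exp (t\<^sup>2 * M\<^sup>2 / 2) ^ n"
    by (simp add: emeasure_eq_measure)
  also have "\<dots> = exp (t * (2 * M + 1) - (1 / (2 * M\<^sup>2)) * \<epsilon>\<^sup>2 * real n)"
  proof -
    have "t * (2 * M + 1 - real n * \<epsilon>) + real n * (t\<^sup>2 * M\<^sup>2 / 2)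
        = t * (2 * M + 1) - (1 / (2 * M\<^sup>2)) * \<epsilon>\<^sup>2 * real n"
      unfolding t_def using M by (simp add: field_simps power2_eq_square)
    then show ?thesis by (simp flip: exp_of_nat_mult exp_add)
  qed
  also have "\<dots> \<le> exp (3 - (1 / (2 * M\<^sup>2)) * \<epsilon>\<^sup>2 * real n)"
  proof -
    have "\<epsilon> * (2 * M + 1) \<le> 1 * (3 * M\<^sup>2)"
    proof (intro mult_mono)
      have "M * 1 \<le> M * M" using M by (intro mult_left_mono) auto
      then show "2 * M + 1 \<le> 3 * M\<^sup>2" using M unfolding power2_eq_square by linarith
    qed (use eps M in auto)
    then have "t * (2 * M + 1) \<le> 3" unfolding t_def using M by (simp add: field_simps)
    then show ?thesis by simp
  qed
  also have "\<dots> = exp 3 * exp (- (1 / (2 * M\<^sup>2)) * \<epsilon>\<^sup>2 * real n)"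
    by (simp flip: exp_add)
  finally show ?thesis unfolding E_def .
qed

section \<open>The chain of pasts\<close>

text \<open>A past is a sequence indexed by \<open>nat\<close>, newest state first.\<close>

abbreviation past_space :: "(nat \<Rightarrow> 'a::metric_space) measure" where
  "past_space \<equiv> \<Pi>\<^sub>M i\<in>UNIV. borel"

definition extend :: "('a::metric_space \<Rightarrow> 'a measure) \<Rightarrow> (nat \<Rightarrow> 'a) \<Rightarrow> (nat \<Rightarrow> 'a) measure" where
  "extend K u = distr (K (u 0)) past_space (\<lambda>y. case_nat y u)"

lemma space_past_space: "space past_space = UNIV"
  by (simp add: space_PiM)

lemma measurable_into_past_space:
  assumes "\<And>k. (\<lambda>x. f x k) \<in> N \<rightarrow>\<^sub>M borel"
  shows "f \<in> N \<rightarrow>\<^sub>M past_space"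
  using measurable_PiM_single'[of UNIV "\<lambda>k x. f x k" N "\<lambda>_. borel"] assms by simp

lemma markov_kernel_space:
  assumes "markov_kernel K"
  shows "prob_space (K x)" "sets (K x) = sets borel" "measurable (K x) N = measurable borel N"
proof -
  show "prob_space (K x)" "sets (K x) = sets borel"
    using kernel_prob_space[of K borel x] assms by (simp_all add: markov_kernel_def)
  then show "measurable (K x) N = measurable borel N" by (intro measurable_cong_sets) auto
qed

lemma measurable_case_nat_const: "(\<lambda>y. case_nat y u) \<in> borel \<rightarrow>\<^sub>M past_space"
  by (rule measurable_case_nat') (auto simp: space_past_space)

lemma extend_kernel:
  assumes "markov_kernel K"
  shows "extend K \<in> past_space \<rightarrow>\<^sub>M prob_algebra past_space"
proof -
  have "(\<lambda>u. K (u 0)) \<in> past_space \<rightarrow>\<^sub>M prob_algebra borel"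
    using assms unfolding markov_kernel_def
    by (rule measurable_compose[rotated]) measurable
  then show ?thesis
    unfolding extend_def by (rule measurable_distr_prob_space2) measurable
qed

text \<open>The set of extensions of \<open>u\<close> is measurable although the space need not have a countable base:
  it is a countable intersection of conditions on one coordinate, and points are closed.\<close>

lemma AE_extend_tail:
  assumes "markov_kernel K"
  shows "AE v in extend K u. (\<lambda>k. v (Suc k)) = u"
proof -
  have "{v \<in> space past_space. \<forall>k. v (Suc k) \<in> {u k}} \<in> sets past_space"
    by measurable
  then show ?thesis unfolding extend_def
    by (subst AE_distr_iff)
       (auto simp: markov_kernel_space[OF assms] measurable_case_nat_const fun_eq_iff)
qed

lemma markov_op_extend:
  assumes "markov_kernel K" "f \<in> borel_measurable past_space"
  shows "markov_op (extend K) f u = (\<integral>y. f (case_nat y u) \<partial>K (u 0))"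
  unfolding markov_op_def extend_def
  by (rule integral_distr) (auto simp: markov_kernel_space[OF assms(1)] measurable_case_nat_const assms)

text \<open>After \<open>m\<close> steps from \<open>u\<close> and from \<open>v\<close> driven by the same new states, the first \<open>m\<close> entries of the
  two pasts are these new states and entry \<open>m\<close> is the common value \<open>u 0 = v 0\<close>. So only older
  entries differ, and \<open>f\<close> hardly sees them. The transitions agree because \<open>K\<close> is applied to equal
  states.\<close>

lemma markov_op_extend_forgets:
  assumes K: "markov_kernel K"
    and f: "f \<in> borel_measurable past_space" "\<And>u. \<bar>f u\<bar> \<le> B"
    and "\<And>u v. (\<And>i. i \<le> m \<Longrightarrow> u i = v i) \<Longrightarrow> \<bar>f u - f v\<bar> \<le> w"
    and "u 0 = v 0"
  shows "\<bar>(markov_op (extend K) ^^ m) f u - (markov_op (extend K) ^^ m) f v\<bar> \<le> w"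
  using assms(2-)
proof (induction m arbitrary: f u v)
  case (Suc m)
  let ?Q = "markov_op (extend K)"
  note mo = markov_op_extend[OF K Suc.prems(1)]
  have "\<bar>(?Q ^^ m) (?Q f) u - (?Q ^^ m) (?Q f) v\<bar> \<le> w"
  proof (rule Suc.IH)
    show "?Q f \<in> borel_measurable past_space"
      by (rule markov_op_measurable[OF extend_kernel[OF K] Suc.prems(1)])
    show "\<bar>?Q f u\<bar> \<le> B" for u
      by (rule markov_op_bounded[OF extend_kernel[OF K] space_past_space Suc.prems(1,2)])
    show "\<bar>?Q f u - ?Q f v\<bar> \<le> w" if uv: "\<And>i. i \<le> m \<Longrightarrow> u i = v i" for u v
    proof -
      interpret prob_space "K (u 0)" by (rule markov_kernel_space[OF K])
      have [measurable]: "(\<lambda>y. f (case_nat y u)) \<in> borel_measurable borel" for u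
        by (rule measurable_compose[OF measurable_case_nat_const Suc.prems(1)])
      have "\<bar>(\<integral>y. f (case_nat y u) \<partial>K (u 0)) - (\<integral>y. f (case_nat y v) \<partial>K (u 0))\<bar> \<le> w"
        by (rule abs_integral_diff_le[of _ _ B B])
           (use uv Suc.prems(2) in \<open>auto simp: markov_kernel_space[OF K] split: nat.split
             intro!: Suc.prems(3)\<close>)
      then show ?thesis using uv[of 0] by (simp add: mo)
    qed
  qed (fact Suc.prems)
  then show ?case by (simp only: funpow_Suc_right o_def)
qed (auto split: nat.split)

lemma markov_op_extend_last_state:
  assumes K: "markov_kernel K" and g: "g \<in> borel_measurable borel" "\<And>z. \<bar>g z\<bar> \<le> B"
  shows "(markov_op (extend K) ^^ i) (\<lambda>u. g (u 0)) u = (markov_op K ^^ i) g (u 0)"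
proof (induction i arbitrary: u)
  case (Suc i)
  have "(markov_op K ^^ i) g \<in> borel_measurable borel"
    by (rule markov_op_funpow_measurable_bounded[OF _ _ g]) (use K in \<open>auto simp: markov_kernel_def\<close>)
  then have "(\<lambda>u. (markov_op K ^^ i) g (u 0)) \<in> borel_measurable past_space"
    by (rule measurable_compose[rotated]) measurable
  moreover have "(markov_op (extend K) ^^ i) (\<lambda>u. g (u 0)) = (\<lambda>u. (markov_op K ^^ i) g (u 0))"
    using Suc by auto
  ultimately show ?case
    using markov_op_extend[OF K] by (simp add: markov_op_def[of K "(markov_op K ^^ i) g"])
qed simp

lemma kernel_pow_kernel:
  assumes "markov_kernel K"
  shows "kernel_pow K n \<in> borel \<rightarrow>\<^sub>M prob_algebra borel"
proof (induction n)
  case 0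
  have "kernel_pow K 0 = return borel" by auto
  then show ?case by simp
next
  case (Suc n)
  have "kernel_pow K (Suc n) = (\<lambda>x. K x \<bind> kernel_pow K n)" by auto
  then show ?case
    using measurable_bind_prob_space[OF assms[unfolded markov_kernel_def] Suc] by simp
qed

lemma markov_op_funpow_eq_kernel_pow:
  assumes K: "markov_kernel K" and g: "g \<in> borel_measurable borel" "\<And>z. \<bar>g z\<bar> \<le> B"
  shows "(markov_op K ^^ i) g x = (\<integral>y. g y \<partial>kernel_pow K i x)"
proof (induction i arbitrary: x)
  case 0
  show ?case using g by (simp add: integral_return)
next
  case (Suc i)
  interpret prob_space "K x" by (rule markov_kernel_space[OF K])
  have kp: "kernel_pow K i \<in> K x \<rightarrow>\<^sub>M subprob_algebra borel"
    using measurable_prob_algebraD[OF kernel_pow_kernel[OF K]]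
    by (simp add: markov_kernel_space[OF K])
  have "prob_space (kernel_pow K i y)" for y
    using kernel_prob_space[OF kernel_pow_kernel[OF K]] by simp
  then have "(\<integral>y. g y \<partial>(K x \<bind> kernel_pow K i)) = (\<integral>y. \<integral>z. g z \<partial>kernel_pow K i y \<partial>K x)"
    by (intro integral_bind[where K = borel and B = B and B' = 1])
       (use g kp finite_measure_axioms in \<open>auto simp: prob_space.emeasure_space_1\<close>)
  then show ?case using Suc by (simp add: markov_op_def[of K "(markov_op K ^^ i) g"])
qed

text \<open>Comparing two starting points instead of a starting point with \<open>\<mu>\<close> removes \<open>\<mu>\<close> from the
  estimate. Constants obtained from one mixing measure therefore serve for all of them, which is
  what makes the final constants depend on \<open>K\<close> only.\<close>

lemma strongly_mixing_contracts:
  assumes K: "markov_kernel K" and mix: "strongly_mixing K \<mu>"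
  shows "\<exists>A>0. \<exists>\<rho>. 0 < \<rho> \<and> \<rho> < 1 \<and> (\<forall>g B x y i. g \<in> borel_measurable borel \<longrightarrow> (\<forall>z. \<bar>g z\<bar> \<le> B) \<longrightarrow>
      \<bar>(markov_op K ^^ i) g x - (markov_op K ^^ i) g y\<bar> \<le> A * B * \<rho> ^ i)"
proof -
  obtain C \<rho> where C: "C > 0" and rho: "0 < \<rho>" "\<rho> < 1"
    and *: "\<And>f :: 'a \<Rightarrow> complex. \<And>x n. f \<in> borel_measurable borel \<Longrightarrow> bounded (range f) \<Longrightarrow> n \<ge> 1 \<Longrightarrow>
      cmod ((\<integral>y. f y \<partial>kernel_pow K n x) - (\<integral>y. f y \<partial>\<mu>)) \<le> C * \<rho> ^ n * sup_norm f"
    using mix unfolding strongly_mixing_def by metis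
  have "\<bar>(markov_op K ^^ i) g x - (markov_op K ^^ i) g y\<bar> \<le> (2 * C + 2) * B * \<rho> ^ i"
    if g: "g \<in> borel_measurable borel" "\<And>z. \<bar>g z\<bar> \<le> B" for g B x y i
  proof (cases "i = 0")
    case True
    have "0 \<le> B" using g(2)[of undefined] by simp
    then have "0 \<le> C * B" using C by simp
    then show ?thesis using g(2)[of x] g(2)[of y] True by (simp add: algebra_simps)
  next
    case False
    have "0 \<le> B" using g(2)[of undefined] by simp
    let ?g = "\<lambda>z. complex_of_real (g z)"
    have gm: "?g \<in> borel_measurable borel" using g(1) by measurable
    have gb: "bounded (range ?g)" unfolding bounded_iff using g(2) by auto
    have "sup_norm ?g \<le> B" unfolding sup_norm_def by (rule cSUP_least) (use g(2) in auto)
    then have "C * \<rho> ^ i * sup_norm ?g \<le> C * \<rho> ^ i * B"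
      using C rho by (intro mult_left_mono) auto
    then have "\<bar>(markov_op K ^^ i) g z - (\<integral>y. g y \<partial>\<mu>)\<bar> \<le> C * \<rho> ^ i * B" for z
      using *[OF gm gb, of i z] False
      by (simp add: markov_op_funpow_eq_kernel_pow[OF K g] flip: of_real_diff)
    from this[of x] this[of y]
    have "\<bar>(markov_op K ^^ i) g x - (markov_op K ^^ i) g y\<bar> \<le> 2 * (C * \<rho> ^ i * B)" by linarith
    also have "\<dots> \<le> (2 * C + 2) * B * \<rho> ^ i"
      using C rho \<open>0 \<le> B\<close> by (simp add: algebra_simps)
    finally show ?thesis .
  qed
  then show ?thesis using C rho by (intro exI[of _ "2 * C + 2"]) auto
qed

text \<open>Split the \<open>n\<close> steps into halves. The later half of the path makes \<open>f\<close> forget everything before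
  its starting state, up to \<open>V * r ^ (n div 2)\<close>; what remains is a function of that one state, and
  during the earlier half the mixing of \<open>K\<close> makes its mean forget the initial state.\<close>

lemma markov_op_extend_oscillation:
  assumes K: "markov_kernel K"
    and contr: "\<And>g B x y i. g \<in> borel_measurable borel \<Longrightarrow> (\<And>z. \<bar>g z\<bar> \<le> B) \<Longrightarrow>
      \<bar>(markov_op K ^^ i) g x - (markov_op K ^^ i) g y\<bar> \<le> A * B * \<rho> ^ i"
    and f: "f \<in> borel_measurable past_space" "\<And>u. \<bar>f u\<bar> \<le> B"
    and osc: "\<And>m u v. (\<And>i. i \<le> m \<Longrightarrow> u i = v i) \<Longrightarrow> \<bar>f u - f v\<bar> \<le> V * r ^ m"
    and "0 < A" "0 \<le> V" "0 \<le> \<rho>" "\<rho> \<le> \<theta>" "0 \<le> r" "r \<le> \<theta>" "\<theta> \<le> 1"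
  shows "\<bar>(markov_op (extend K) ^^ n) f u - (markov_op (extend K) ^^ n) f v\<bar> \<le> (2 * V + A * B) * \<theta> ^ (n div 2)"
proof -
  let ?Q = "markov_op (extend K)"
  note L = extend_kernel[OF K] space_past_space
  define m where "m = n div 2"
  define i where "i = n - m"
  have n: "n = i + m" and i: "m \<le> i" unfolding i_def m_def by auto
  have B: "0 \<le> B" using f(2)[of undefined] by simp
  \<comment> \<open>any past whose newest state is \<open>z\<close> would do; the constant one depends measurably on \<open>z\<close>\<close>
  define g where "g z = (?Q ^^ m) f (\<lambda>_. z)" for z
  have const: "(\<lambda>z. (\<lambda>_. z)) \<in> borel \<rightarrow>\<^sub>M past_space"
    by (rule measurable_into_past_space) simp
  have Qm: "(?Q ^^ m) f \<in> borel_measurable past_space" by (rule markov_op_funpow_measurable_bounded[OF L f])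
  have Qb: "\<bar>(?Q ^^ m) f w\<bar> \<le> B" for w by (rule markov_op_funpow_measurable_bounded[OF L f])
  have g: "g \<in> borel_measurable borel" "\<bar>g z\<bar> \<le> B" for z
    unfolding g_def using measurable_compose[OF const Qm] Qb by auto
  have g0: "(\<lambda>w. g (w 0)) \<in> borel_measurable past_space"
    using g(1) by (rule measurable_compose[rotated]) measurable
  have close: "\<bar>(?Q ^^ m) f w - g (w 0)\<bar> \<le> V * r ^ m" for w
    unfolding g_def by (rule markov_op_extend_forgets[OF K f osc]) auto
  have *: "\<bar>(?Q ^^ n) f w - (markov_op K ^^ i) g (w 0)\<bar> \<le> V * r ^ m" for w
    using markov_op_funpow_diff_le[OF L Qm g0 Qb g(2) close, of i w]
    by (simp add: n funpow_add markov_op_extend_last_state[OF K g])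
  have "\<bar>(?Q ^^ n) f u - (?Q ^^ n) f v\<bar> \<le> 2 * (V * r ^ m) + A * B * \<rho> ^ i"
    using *[of u] *[of v] contr[OF g, of i "u 0" "v 0"] by linarith
  also have "\<dots> \<le> 2 * (V * \<theta> ^ m) + A * B * \<theta> ^ m"
  proof -
    have "\<rho> ^ i \<le> \<theta> ^ i" "r ^ m \<le> \<theta> ^ m" using assms by (auto intro!: power_mono)
    moreover have "\<theta> ^ i \<le> \<theta> ^ m" using assms i by (intro power_decreasing) auto
    ultimately show ?thesis using \<open>0 < A\<close> \<open>0 \<le> V\<close> B by (intro add_mono mult_left_mono) auto
  qed
  finally show ?thesis by (simp add: m_def algebra_simps)
qed

lemma sum_power_div2_le:
  fixes \<theta> :: real
  assumes "0 \<le> \<theta>" "\<theta> < 1"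
  shows "(\<Sum>j<N. \<theta> ^ (j div 2)) \<le> 2 / (1 - \<theta>)"
proof -
  have "(\<Sum>j<N. \<theta> ^ (j div 2)) \<le> (\<Sum>j<2 * N. \<theta> ^ (j div 2))"
    using assms by (intro sum_mono2) auto
  also have "(\<Sum>j<2 * N. \<theta> ^ (j div 2)) = 2 * (\<Sum>j<N. \<theta> ^ j)"
    by (induction N) auto
  also have "\<dots> = 2 * ((1 - \<theta> ^ N) / (1 - \<theta>))"
    using assms by (simp add: sum_gp_strict)
  also have "\<dots> \<le> 2 / (1 - \<theta>)" using assms by (simp add: divide_right_mono)
  finally show ?thesis .
qed

section \<open>The law of the past is stationary\<close>

text \<open>The law of the current state, restricted to the event that the chain with initial law \<open>\<mu>\<close> has
  visited the sets of the list. The head of the list is the set visited last, as in a past, so this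
  recursion runs opposite to that of \<open>path_prob\<close>. The initial state, one step before the last set
  of the list, is unconstrained.\<close>

primrec arrival :: "('a::metric_space \<Rightarrow> 'a measure) \<Rightarrow> 'a measure \<Rightarrow> 'a set list \<Rightarrow> 'a measure" where
  "arrival K \<mu> [] = \<mu>"
| "arrival K \<mu> (B # Bs) = density (arrival K \<mu> Bs \<bind> K) (indicator B)"

lemma sets_bind_kernel:
  assumes "markov_kernel K" "sets N = sets (borel :: 'a::metric_space measure)"
  shows "sets (N \<bind> K) = sets borel"
proof (rule sets_bind)
  show "space N \<noteq> {}" using sets_eq_imp_space_eq[OF assms(2)] by simp
qed (use markov_kernel_space(2)[OF assms(1)] in auto)

lemma sets_arrival:
  assumes "markov_kernel K" "sets \<mu> = sets borel"
  shows "sets (arrival K \<mu> Bs) = sets borel"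
  by (induction Bs) (auto simp: assms sets_bind_kernel)

lemma nn_integral_bind_kernel:
  assumes "markov_kernel K" "sets N = sets borel" "f \<in> borel_measurable borel"
  shows "(\<integral>\<^sup>+x. f x \<partial>(N \<bind> K)) = (\<integral>\<^sup>+x. \<integral>\<^sup>+y. f y \<partial>K x \<partial>N)"
  using assms measurable_prob_algebraD[of K borel borel] unfolding markov_kernel_def
  by (intro nn_integral_bind[where B = borel]) (simp_all add: measurable_cong_sets[OF assms(2) refl])

lemma path_prob_measurable:
  assumes "markov_kernel K" "set L \<subseteq> sets borel"
  shows "path_prob K L \<in> borel_measurable borel"
  using assms(2)
proof (induction L)
  case Nil
  have "path_prob K [] = (\<lambda>_. 1)" by auto
  then show ?case by simp
next
  case (Cons A L)
  have "path_prob K (A # L) = (\<lambda>x. \<integral>\<^sup>+y\<in>A. path_prob K L y \<partial>K x)" by auto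
  moreover have "(\<lambda>y. path_prob K L y * indicator A y) \<in> borel_measurable borel"
    using Cons by (intro borel_measurable_times_ennreal borel_measurable_indicator) auto
  ultimately show ?case
    using assms(1) measurable_compose[OF measurable_prob_algebraD nn_integral_measurable_subprob_algebra]
    unfolding markov_kernel_def by auto
qed

text \<open>The two recursions meet: sets are moved one at a time from the front of the list of
  \<open>path_prob\<close>, where the earliest is, to the front of the list of \<open>arrival\<close>.\<close>

lemma nn_integral_path_prob:
  assumes K: "markov_kernel K" "sets \<mu> = sets borel"
    and "set Bs \<subseteq> sets borel" "set L \<subseteq> sets borel"
  shows "(\<integral>\<^sup>+x. path_prob K (rev Bs @ L) x \<partial>\<mu>) = (\<integral>\<^sup>+x. path_prob K L x \<partial>arrival K \<mu> Bs)"
  using assms(3-)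
proof (induction Bs arbitrary: L)
  case (Cons B Bs)
  have s: "sets (arrival K \<mu> Bs \<bind> K) = sets borel"
    by (simp add: sets_bind_kernel sets_arrival assms)
  have B: "B \<in> sets borel" and p: "path_prob K L \<in> borel_measurable borel"
    using Cons path_prob_measurable[OF K(1)] by auto
  have "(\<integral>\<^sup>+x. path_prob K (rev (B # Bs) @ L) x \<partial>\<mu>) = (\<integral>\<^sup>+x. path_prob K (B # L) x \<partial>arrival K \<mu> Bs)"
    using Cons.IH[of "B # L"] Cons.prems by (simp del: path_prob.simps)
  also have "\<dots> = (\<integral>\<^sup>+x. path_prob K L x * indicator B x \<partial>(arrival K \<mu> Bs \<bind> K))"
    using B p
    by (subst nn_integral_bind_kernel[OF K(1) sets_arrival[OF K]]) (auto intro!: nn_integral_cong)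
  also have "\<dots> = (\<integral>\<^sup>+x. path_prob K L x \<partial>arrival K \<mu> (B # Bs))"
    using B p
    by (simp add: nn_integral_density measurable_cong_sets[OF s refl] mult.commute)
  finally show ?case .
qed simp

lemma stationary_bind:
  assumes "markov_system K \<mu>"
  shows "\<mu> \<bind> K = \<mu>"
proof (rule measure_eqI)
  have K: "markov_kernel K" "sets \<mu> = sets borel" "prob_space \<mu>" "stationary K \<mu>"
    using assms by (auto simp: markov_system_def)
  show s: "sets (\<mu> \<bind> K) = sets \<mu>" using K sets_bind_kernel by auto
  fix A assume "A \<in> sets (\<mu> \<bind> K)"
  then have A: "A \<in> sets borel" using s K by simp
  have "emeasure (\<mu> \<bind> K) A = (\<integral>\<^sup>+x. indicator A x \<partial>(\<mu> \<bind> K))"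
    using A s K by simp
  also have "\<dots> = (\<integral>\<^sup>+x. \<integral>\<^sup>+y. indicator A y \<partial>K x \<partial>\<mu>)"
    using A by (intro nn_integral_bind_kernel K) simp
  also have "\<dots> = emeasure \<mu> A"
    using K(4) A unfolding stationary_def by (simp add: markov_kernel_space[OF K(1)])
  finally show "emeasure (\<mu> \<bind> K) A = emeasure \<mu> A" .
qed

definition cylinder :: "'a set list \<Rightarrow> (nat \<Rightarrow> 'a) set" where
  "cylinder Bs = {u. \<forall>i<length Bs. u i \<in> Bs ! i}"

lemma cylinder_Nil: "cylinder [] = UNIV"
  by (simp add: cylinder_def)

lemma cylinder_Cons: "u \<in> cylinder (B # Bs) \<longleftrightarrow> u 0 \<in> B \<and> (\<lambda>k. u (Suc k)) \<in> cylinder Bs"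
  by (simp add: cylinder_def All_less_Suc2)

lemma cylinder_sets:
  assumes "set Bs \<subseteq> sets borel"
  shows "cylinder Bs \<in> sets past_space"
proof -
  have "{u \<in> space past_space. u i \<in> Bs ! i} \<in> sets past_space" if "i < length Bs" for i
  proof -
    have "Bs ! i \<in> sets borel" using assms that by auto
    then show ?thesis by measurable
  qed
  then have "{u \<in> space past_space. \<forall>i\<in>{..<length Bs}. u i \<in> Bs ! i} \<in> sets past_space"
    by (intro sets.sets_Collect_finite_All) auto
  then show ?thesis by (simp add: cylinder_def space_past_space Ball_def)
qed

text \<open>Full cylinders over an initial segment of indices generate, since a condition on finitely many
  coordinates extends to an initial segment with trivial conditions in between.\<close>

lemma past_measure_eqI:
  fixes \<nu> \<nu>' :: "(nat \<Rightarrow> 'a::metric_space) measure"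
  assumes "prob_space \<nu>" "sets \<nu> = sets past_space" "sets \<nu>' = sets past_space"
    and eq: "\<And>Bs. set Bs \<subseteq> sets borel \<Longrightarrow> emeasure \<nu> (cylinder Bs) = emeasure \<nu>' (cylinder Bs)"
  shows "\<nu> = \<nu>'"
proof (rule measure_eqI_PiM_infinite[OF assms(2,3)])
  interpret prob_space \<nu> by fact
  show "finite_measure \<nu>" by unfold_locales
  fix A :: "nat \<Rightarrow> 'a set" and J :: "nat set"
  assume J: "finite J" and A: "\<And>i. i \<in> J \<Longrightarrow> A i \<in> sets borel"
  let ?Bs = "map (\<lambda>i. if i \<in> J then A i else UNIV) [0..<Suc (Max (insert 0 J))]"
  have lt: "i < Suc (Max (insert 0 J))" if "i \<in> J" for i
    using J that by (simp add: less_Suc_eq_le)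
  have "u \<in> cylinder ?Bs \<longleftrightarrow> (\<forall>i\<in>J. u i \<in> A i)" for u
    unfolding cylinder_def using lt by (force simp del: upt_Suc)
  moreover have "u \<in> prod_emb UNIV (\<lambda>_. borel) J (Pi\<^sub>E J A) \<longleftrightarrow> (\<forall>i\<in>J. u i \<in> A i)" for u
    by (simp add: prod_emb_def PiE_iff restrict_def extensional_def)
  ultimately have "prod_emb UNIV (\<lambda>_. borel) J (Pi\<^sub>E J A) = cylinder ?Bs"
    by blast
  then show "emeasure \<nu> (prod_emb UNIV (\<lambda>_. borel) J (Pi\<^sub>E J A))
      = emeasure \<nu>' (prod_emb UNIV (\<lambda>_. borel) J (Pi\<^sub>E J A))"
  proof -
    have "set ?Bs \<subseteq> sets borel" using A by (auto simp del: upt_Suc)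
    then show ?thesis using eq[of ?Bs] \<open>prod_emb _ _ _ _ = _\<close> by simp
  qed
qed

definition past_at :: "int \<Rightarrow> (int \<Rightarrow> 'a) \<Rightarrow> nat \<Rightarrow> 'a" where
  "past_at m x k = x (m - int k)"

lemma past_at_measurable: "past_at m \<in> borel \<rightarrow>\<^sub>M past_space"
  by (rule measurable_into_past_space)
     (auto simp: past_at_def intro!: borel_measurable_continuous_onI)

text \<open>The right-hand side does not involve \<open>m\<close>, so this carries shift invariance. The given
  distributions start with \<open>\<mu>\<close> on the first set while \<open>arrival\<close> starts one step earlier; since
  \<open>\<mu> \<bind> K = \<mu>\<close>, both describe the same chain.\<close>

lemma emeasure_past_cylinder:
  assumes sys: "markov_system K \<mu>" and law: "markov_chain_law K \<mu> P" and Bs: "set Bs \<subseteq> sets borel"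
  shows "emeasure (distr P past_space (past_at m)) (cylinder Bs) = emeasure (arrival K \<mu> Bs) UNIV"
proof -
  have K: "markov_kernel K" "sets \<mu> = sets borel" "prob_space \<mu>"
    using sys by (auto simp: markov_system_def)
  have sp: "space \<mu> = UNIV" using sets_eq_imp_space_eq[OF K(2)] by simp
  have P: "prob_space P" "sets P = sets borel"
    and fdd: "\<And>m A As. set (A # As) \<subseteq> sets borel \<Longrightarrow>
        emeasure P {x. \<forall>i<length (A # As). x (m + int i) \<in> (A # As) ! i}
          = (\<integral>\<^sup>+y\<in>A. path_prob K As y \<partial>\<mu>)"
    using law unfolding markov_chain_law_def by auto
  have spP: "space P = UNIV" using sets_eq_imp_space_eq[OF P(2)] by simp
  have e: "emeasure (distr P past_space (past_at m)) (cylinder Bs) = emeasure P {x. past_at m x \<in> cylinder Bs}"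
    using past_at_measurable cylinder_sets[OF Bs]
    by (subst emeasure_distr) (auto simp: measurable_cong_sets[OF P(2) refl] spP vimage_def)
  show ?thesis
  proof (cases "rev Bs")
    case Nil
    then show ?thesis
      using e prob_space.emeasure_space_1[OF P(1)] prob_space.emeasure_space_1[OF K(3)] sp spP
      by (simp add: cylinder_Nil)
  next
    case (Cons A As)
    have len: "length Bs = Suc (length As)" using arg_cong[OF Cons, of length] by simp
    have sub: "set (A # As) \<subseteq> sets borel" using Bs by (metis Cons set_rev)
    have "{x. past_at m x \<in> cylinder Bs}
        = {x. \<forall>i<length (A # As). x (m - int (length As) + int i) \<in> (A # As) ! i}"
    proof -
      have "past_at m x \<in> cylinder Bs \<longleftrightarrow>
          (\<forall>i<length (A # As). x (m - int (length As) + int i) \<in> (A # As) ! i)" for x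
      proof
        assume a: "past_at m x \<in> cylinder Bs"
        show "\<forall>i<length (A # As). x (m - int (length As) + int i) \<in> (A # As) ! i"
        proof (intro allI impI)
          fix i assume i: "i < length (A # As)"
          then have "length As - i < length Bs" using len by simp
          then have "x (m - int (length As - i)) \<in> Bs ! (length As - i)"
            using a by (simp add: cylinder_def past_at_def)
          moreover have "(A # As) ! i = Bs ! (length As - i)"
            using i len by (simp add: Cons[symmetric] rev_nth)
          ultimately show "x (m - int (length As) + int i) \<in> (A # As) ! i"
            using i by (simp add: of_nat_diff algebra_simps)
        qed
      next
        assume a: "\<forall>i<length (A # As). x (m - int (length As) + int i) \<in> (A # As) ! i"
        show "past_at m x \<in> cylinder Bs"
          unfolding cylinder_def past_at_def
        proof (intro CollectI allI impI)
          fix i assume i: "i < length Bs"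
          then have i': "length As - i < length (A # As)" "i \<le> length As" using len by auto
          have "(A # As) ! (length As - i) = Bs ! i"
            using i i' len by (simp add: Cons[symmetric] rev_nth)
          then show "x (m - int i) \<in> Bs ! i"
            using a[rule_format, OF i'(1)] i'(2) by (simp add: of_nat_diff algebra_simps)
        qed
      qed
      then show ?thesis by simp
    qed
    then have "emeasure P {x. past_at m x \<in> cylinder Bs} = (\<integral>\<^sup>+y\<in>A. path_prob K As y \<partial>\<mu>)"
      using fdd[OF sub] by simp
    also have "\<dots> = (\<integral>\<^sup>+y\<in>A. path_prob K As y \<partial>(\<mu> \<bind> K))"
      by (simp add: stationary_bind[OF sys])
    also have "\<dots> = (\<integral>\<^sup>+x. path_prob K (A # As) x \<partial>\<mu>)"
      using sub path_prob_measurable[OF K(1), of As]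
      by (subst nn_integral_bind_kernel[OF K(1,2)]) (auto intro!: nn_integral_cong)
    also have "\<dots> = (\<integral>\<^sup>+x. path_prob K (rev Bs @ []) x \<partial>\<mu>)"
      by (simp only: Cons append_Nil2)
    also have "\<dots> = (\<integral>\<^sup>+x. path_prob K [] x \<partial>arrival K \<mu> Bs)"
      using Bs by (intro nn_integral_path_prob K) auto
    also have "\<dots> = emeasure (arrival K \<mu> Bs) UNIV"
      using sets_eq_imp_space_eq[OF sets_arrival[OF K(1,2), of Bs]] by simp
    finally show ?thesis using e by simp
  qed
qed

lemma past_law_prob:
  assumes "markov_chain_law K \<mu> P"
  shows "prob_space (distr P past_space (past_at m))"
  using assms past_at_measurable
  by (intro prob_space.prob_space_distr)
     (auto simp: markov_chain_law_def cong: measurable_cong_sets)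

lemma past_law_shift_invariant:
  assumes "markov_system K \<mu>" "markov_chain_law K \<mu> P"
  shows "distr P past_space (past_at m) = distr P past_space (past_at m')"
  by (rule past_measure_eqI[OF past_law_prob[OF assms(2)]])
     (auto simp: emeasure_past_cylinder[OF assms])

text \<open>Testing the newest state against \<open>A\<close> amounts to shrinking the newest set of the cylinder to its
  intersection with \<open>A\<close>, which gives a cylinder again. This upgrades the values of \<open>\<nu>\<close> on cylinders
  to integrals of functions of the newest state over cylinders.\<close>

lemma last_state_law:
  assumes sys: "markov_system K \<mu>"
    and nu: "sets \<nu> = sets past_space"
    and cyl: "\<And>Bs. set Bs \<subseteq> sets borel \<Longrightarrow> emeasure \<nu> (cylinder Bs) = emeasure (arrival K \<mu> Bs) UNIV"
    and Bs: "set Bs \<subseteq> sets borel"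
  shows "distr (density \<nu> (indicator (cylinder Bs))) borel (\<lambda>u. u 0) = arrival K \<mu> Bs"
proof (rule measure_eqI)
  have K: "markov_kernel K" "sets \<mu> = sets borel" using sys by (auto simp: markov_system_def)
  show "sets (distr (density \<nu> (indicator (cylinder Bs))) borel (\<lambda>u. u 0)) = sets (arrival K \<mu> Bs)"
    by (simp add: sets_arrival[OF K])
  fix A assume "A \<in> sets (distr (density \<nu> (indicator (cylinder Bs))) borel (\<lambda>u. u 0))"
  then have A: "A \<in> sets borel" by simp
  have sp: "space \<nu> = UNIV" using sets_eq_imp_space_eq[OF nu] space_past_space by metis
  have m: "(\<lambda>u. u 0) \<in> \<nu> \<rightarrow>\<^sub>M borel" by (simp add: measurable_cong_sets[OF nu refl])
  have A0: "{u. u 0 \<in> A} \<in> sets \<nu>"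
    using measurable_sets[OF m A] by (simp add: sp vimage_def)
  have "emeasure (distr (density \<nu> (indicator (cylinder Bs))) borel (\<lambda>u. u 0)) A
      = emeasure (density \<nu> (indicator (cylinder Bs))) {u. u 0 \<in> A}"
    using A m by (subst emeasure_distr) (auto simp: sp vimage_def)
  also have "\<dots> = emeasure \<nu> (cylinder Bs \<inter> {u. u 0 \<in> A})"
    using A0 cylinder_sets[OF Bs] nu by (intro emeasure_restricted) auto
  also have "\<dots> = emeasure (arrival K \<mu> Bs) A"
  proof (cases Bs)
    case Nil
    have "cylinder Bs \<inter> {u. u 0 \<in> A} = cylinder [A]" by (auto simp: Nil cylinder_def)
    then have "emeasure \<nu> (cylinder Bs \<inter> {u. u 0 \<in> A}) = emeasure (density \<mu> (indicator A)) UNIV"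
      using cyl[of "[A]"] A by (simp add: stationary_bind[OF sys])
    also have "\<dots> = emeasure \<mu> A"
      using A K(2) by (simp add: emeasure_restricted)
    finally show ?thesis by (simp add: Nil)
  next
    case (Cons B Bs')
    let ?N = "arrival K \<mu> Bs' \<bind> K"
    have s: "sets ?N = sets borel" by (simp add: sets_bind_kernel sets_arrival K)
    have B: "B \<in> sets borel" using Bs Cons by simp
    have "cylinder Bs \<inter> {u. u 0 \<in> A} = cylinder ((B \<inter> A) # Bs')" by (auto simp: Cons cylinder_Cons)
    then have "emeasure \<nu> (cylinder Bs \<inter> {u. u 0 \<in> A}) = emeasure (density ?N (indicator (B \<inter> A))) UNIV"
      using cyl[of "(B \<inter> A) # Bs'"] A Bs Cons by (simp add: sets.Int)
    also have "\<dots> = emeasure (density ?N (indicator B)) A"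
      using A B s by (simp add: emeasure_restricted sets.Int Int_commute)
    finally show ?thesis by (simp add: Cons)
  qed
  finally show "emeasure (distr (density \<nu> (indicator (cylinder Bs))) borel (\<lambda>u. u 0)) A
      = emeasure (arrival K \<mu> Bs) A" .
qed

text \<open>On a cylinder over \<open>B # Bs'\<close>, one step of the chain contributes \<open>K (u 0) B\<close> integrated over the
  cylinder of \<open>Bs'\<close>, and this is how \<open>arrival\<close> passes from \<open>Bs'\<close> to \<open>B # Bs'\<close>.\<close>

lemma past_law_stationary:
  assumes sys: "markov_system K \<mu>" and law: "markov_chain_law K \<mu> P"
  shows "distr P past_space (past_at m) \<bind> extend K = distr P past_space (past_at m)"
proof -
  define \<nu> where "\<nu> = distr P past_space (past_at m)"
  have K: "markov_kernel K" "sets \<mu> = sets borel" using sys by (auto simp: markov_system_def)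
  have s: "sets \<nu> = sets past_space" by (simp add: \<nu>_def)
  have nu: "prob_space \<nu>" unfolding \<nu>_def by (rule past_law_prob[OF law])
  have cyl: "emeasure \<nu> (cylinder Bs) = emeasure (arrival K \<mu> Bs) UNIV" if "set Bs \<subseteq> sets borel" for Bs
    unfolding \<nu>_def by (rule emeasure_past_cylinder[OF sys law that])
  have nu_in: "\<nu> \<in> space (prob_algebra past_space)" using nu s by (simp add: space_prob_algebra)
  have "\<nu> = \<nu> \<bind> extend K"
  proof (rule past_measure_eqI[OF nu s sets_bind'[OF nu_in extend_kernel[OF K(1)]]])
    fix Bs :: "'a set list" assume Bs: "set Bs \<subseteq> sets borel"
    show "emeasure \<nu> (cylinder Bs) = emeasure (\<nu> \<bind> extend K) (cylinder Bs)"
    proof (cases Bs)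
      case Nil
      have p: "prob_space (\<nu> \<bind> extend K)" by (rule prob_space_bind'[OF nu_in extend_kernel[OF K(1)]])
      have "space (\<nu> \<bind> extend K) = UNIV" "space \<nu> = UNIV"
        using sets_eq_imp_space_eq[OF sets_bind'[OF nu_in extend_kernel[OF K(1)]]]
          sets_eq_imp_space_eq[OF s] space_past_space by metis+
      then show ?thesis
        using prob_space.emeasure_space_1[OF p] prob_space.emeasure_space_1[OF nu]
        by (simp add: Nil cylinder_Nil)
    next
      case (Cons B Bs')
      have B: "B \<in> sets borel" and Bs': "set Bs' \<subseteq> sets borel" using Bs Cons by auto
      have Km: "(\<lambda>z. emeasure (K z) B) \<in> borel_measurable borel"
        using measurable_compose[OF measurable_prob_algebraD measurable_emeasure_subprob_algebra] K(1) B
        unfolding markov_kernel_def by auto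
      have Km0: "(\<lambda>u. emeasure (K (u 0)) B) \<in> borel_measurable past_space"
        by (rule measurable_compose[OF _ Km]) simp
      have ext: "emeasure (extend K u) (cylinder (B # Bs')) = indicator (cylinder Bs') u * emeasure (K (u 0)) B" for u
      proof -
        have "emeasure (extend K u) (cylinder (B # Bs')) = emeasure (K (u 0)) {y. case_nat y u \<in> cylinder (B # Bs')}"
          unfolding extend_def using cylinder_sets[OF Bs] Cons
            sets_eq_imp_space_eq[OF markov_kernel_space(2)[OF K(1)]]
          by (subst emeasure_distr)
             (auto simp: markov_kernel_space[OF K(1)] measurable_case_nat_const vimage_def)
        also have "{y. case_nat y u \<in> cylinder (B # Bs')} = (if u \<in> cylinder Bs' then B else {})"
          by (auto simp: cylinder_Cons)
        finally show ?thesis by simp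
      qed
      have "emeasure (\<nu> \<bind> extend K) (cylinder Bs) = (\<integral>\<^sup>+u. emeasure (extend K u) (cylinder Bs) \<partial>\<nu>)"
        using emeasure_bind_prob_algebra[OF nu_in extend_kernel[OF K(1)] cylinder_sets[OF Bs]] .
      also have "\<dots> = (\<integral>\<^sup>+u. indicator (cylinder Bs') u * emeasure (K (u 0)) B \<partial>\<nu>)"
        by (simp add: Cons ext)
      also have "\<dots> = (\<integral>\<^sup>+u. emeasure (K (u 0)) B \<partial>density \<nu> (indicator (cylinder Bs')))"
        using cylinder_sets[OF Bs'] Km0 s
        by (subst nn_integral_density) (auto simp: measurable_cong_sets[OF s refl])
      also have "\<dots> = (\<integral>\<^sup>+z. emeasure (K z) B \<partial>distr (density \<nu> (indicator (cylinder Bs'))) borel (\<lambda>u. u 0))"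
        using Km by (subst nn_integral_distr) (auto simp: measurable_cong_sets[OF s refl])
      also have "\<dots> = (\<integral>\<^sup>+z. emeasure (K z) B \<partial>arrival K \<mu> Bs')"
        by (simp add: last_state_law[OF sys s cyl Bs'])
      also have "\<dots> = (\<integral>\<^sup>+z. indicator B z \<partial>(arrival K \<mu> Bs' \<bind> K))"
        using B by (subst nn_integral_bind_kernel[OF K(1) sets_arrival[OF K]])
                   (auto simp: markov_kernel_space[OF K(1)])
      also have "\<dots> = emeasure (arrival K \<mu> (B # Bs')) UNIV"
      proof -
        have s': "sets (arrival K \<mu> Bs' \<bind> K) = sets borel" by (simp add: sets_bind_kernel sets_arrival K)
        show ?thesis
          using emeasure_restricted[of B "arrival K \<mu> Bs' \<bind> K" UNIV] B s' by simp
      qed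
      also have "\<dots> = emeasure \<nu> (cylinder Bs)" using cyl[OF Bs] Cons by simp
      finally show ?thesis by simp
    qed
  qed
  then show ?thesis by (simp add: \<nu>_def)
qed

section \<open>Measurability in the compact product\<close>

lemma compact_countable_base:
  assumes "compact (UNIV :: 'a::metric_space set)"
  obtains \<B> :: "'a::metric_space set set" where "countable \<B>" "\<And>b. b \<in> \<B> \<Longrightarrow> open b"
    "\<And>U x. open U \<Longrightarrow> x \<in> U \<Longrightarrow> \<exists>b\<in>\<B>. x \<in> b \<and> b \<subseteq> U"
proof -
  have "\<forall>n::nat. \<exists>F::'a set. finite F \<and> UNIV \<subseteq> (\<Union>x\<in>F. ball x (1 / Suc n))"
    using assms unfolding compact_eq_totally_bounded by auto
  then obtain F :: "nat \<Rightarrow> 'a set" where F: "\<And>n. finite (F n)" "\<And>n. UNIV \<subseteq> (\<Union>x\<in>F n. ball x (1 / Suc n))"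
    by metis
  show thesis
  proof
    show "countable (\<Union>n. (\<lambda>x. ball x (1 / Suc n)) ` F n)"
      using F(1) by (auto intro: countable_finite)
    show "open b" if "b \<in> (\<Union>n. (\<lambda>x. ball x (1 / Suc n)) ` F n)" for b
      using that by auto
    fix U and x :: 'a assume U: "open U" "x \<in> U"
    then obtain e where e: "e > 0" "ball x e \<subseteq> U" unfolding open_contains_ball by auto
    then obtain n where "1 / real (Suc n) < e / 2"
      using reals_Archimedean[of "e / 2"] by (auto simp: inverse_eq_divide)
    moreover obtain y where y: "y \<in> F n" "x \<in> ball y (1 / Suc n)" using F(2)[of n] by blast
    ultimately have "ball y (1 / Suc n) \<subseteq> ball x e"
    proof (intro subsetI)
      fix z assume n: "1 / real (Suc n) < e / 2" and "z \<in> ball y (1 / Suc n)"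
      then show "z \<in> ball x e"
        using y(2) dist_triangle3[of x z y] unfolding mem_ball by linarith
    qed
    then show "\<exists>b\<in>(\<Union>n. (\<lambda>x. ball x (1 / Suc n)) ` F n). x \<in> b \<and> b \<subseteq> U"
      using y e by blast
  qed
qed

text \<open>In general the Borel \<open>\<sigma>\<close>-field of a product topology is larger than the \<open>\<sigma>\<close>-field generated by
  the coordinates. Compactness supplies a countable base of the factor, hence one of the product
  that consists of boxes restricting finitely many coordinates, and then the two agree.\<close>

lemma measurable_into_fun_borel:
  fixes g :: "'b \<Rightarrow> ('i::countable \<Rightarrow> 'a::metric_space)"
  assumes "compact (UNIV :: 'a set)" and g: "\<And>i. (\<lambda>w. g w i) \<in> N \<rightarrow>\<^sub>M borel"
  shows "g \<in> N \<rightarrow>\<^sub>M borel"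
proof (rule borel_measurableI)
  fix U :: "('i \<Rightarrow> 'a) set" assume U: "open U"
  obtain \<B> :: "'a set set" where B: "countable \<B>" "\<And>b. b \<in> \<B> \<Longrightarrow> open b"
    "\<And>U x. open U \<Longrightarrow> x \<in> U \<Longrightarrow> \<exists>b\<in>\<B>. x \<in> b \<and> b \<subseteq> U"
    using compact_countable_base[OF assms(1)] by metis
  define cell where "cell = (\<lambda>(J :: 'i set, b :: 'i \<Rightarrow> 'a set). {x. \<forall>i\<in>J. x i \<in> b i})"
  define \<C> where "\<C> = (SIGMA J:{J :: 'i set. finite J}. PiE J (\<lambda>_. \<B>))"
  have "countable \<C>" unfolding \<C>_def
    by (intro countable_SIGMA countable_Collect_finite countable_PiE) (auto simp: B)
  then have cnt: "countable {c \<in> \<C>. cell c \<subseteq> U}" by (rule countable_subset[rotated]) auto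
  have "U = (\<Union>c\<in>{c \<in> \<C>. cell c \<subseteq> U}. cell c)"
  proof (intro equalityI subsetI)
    fix x assume "x \<in> U"
    then obtain X where X: "\<And>i. x i \<in> X i" "\<And>i. open (X i)" "finite {i. X i \<noteq> UNIV}" "(\<Pi>\<^sub>E i\<in>UNIV. X i) \<subseteq> U"
      using product_topology_open_contains_basis[OF U[unfolded open_fun_def], of x]
      by (simp add: PiE_iff) metis
    let ?J = "{i. X i \<noteq> UNIV}"
    obtain b where b: "\<And>i. b i \<in> \<B>" "\<And>i. x i \<in> b i" "\<And>i. b i \<subseteq> X i"
      using B(3)[OF X(2) X(1)] by metis
    have "(?J, restrict b ?J) \<in> \<C>" using X(3) b(1) by (auto simp: \<C>_def)
    moreover have "cell (?J, restrict b ?J) \<subseteq> U"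
    proof
      fix y assume "y \<in> cell (?J, restrict b ?J)"
      then have "y i \<in> X i" for i using b(3)[of i] by (cases "X i = UNIV") (auto simp: cell_def)
      then show "y \<in> U" using X(4) by auto
    qed
    moreover have "x \<in> cell (?J, restrict b ?J)" using b(2) by (auto simp: cell_def)
    ultimately show "x \<in> (\<Union>c\<in>{c \<in> \<C>. cell c \<subseteq> U}. cell c)" by blast
  qed auto
  then have "g -` U \<inter> space N = g -` (\<Union>c\<in>{c \<in> \<C>. cell c \<subseteq> U}. cell c) \<inter> space N"
    by (rule arg_cong)
  then have "g -` U \<inter> space N = (\<Union>c\<in>{c \<in> \<C>. cell c \<subseteq> U}. g -` cell c \<inter> space N)"
    by (simp only: vimage_UN Int_commute[of _ "space N"] Int_UN_distrib)
  moreover have "g -` cell c \<inter> space N \<in> sets N" if "c \<in> \<C>" for c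
  proof -
    obtain J b where c: "c = (J, b)" "finite J" "\<And>i. i \<in> J \<Longrightarrow> b i \<in> \<B>"
      using \<open>c \<in> \<C>\<close> unfolding \<C>_def by auto
    have "{w \<in> space N. \<forall>i\<in>J. g w i \<in> b i} \<in> sets N"
    proof (rule sets.sets_Collect_finite_All[OF _ c(2)])
      fix i assume "i \<in> J"
      then have "b i \<in> sets borel" using c(3) B(2) by auto
      then have "(\<lambda>w. g w i) -` b i \<inter> space N \<in> sets N" by (rule measurable_sets[OF g])
      then show "{w \<in> space N. g w i \<in> b i} \<in> sets N" by (simp add: vimage_def Int_def conj_commute)
    qed
    then show ?thesis by (simp add: c cell_def vimage_def Int_def conj_commute)
  qed
  ultimately show "g -` U \<inter> space N \<in> sets N"
    using sets.countable_UN''[OF cnt, of "\<lambda>c. g -` cell c \<inter> space N" N] by simp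
qed

section \<open>Hoelder observables as functions of the past\<close>

text \<open>At positive times \<open>nat (- k) = 0\<close>, so the present state is repeated. Two extensions then differ
  at a positive time only if they differ at time \<open>0\<close>, so \<open>seq_dist\<close> of the extensions depends only
  on the first disagreement of the pasts.\<close>

definition past_extension :: "(nat \<Rightarrow> 'a) \<Rightarrow> int \<Rightarrow> 'a" where
  "past_extension u k = u (nat (- k))"

lemma past_extension_measurable:
  assumes "compact (UNIV :: 'a::metric_space set)"
  shows "(past_extension :: (nat \<Rightarrow> 'a) \<Rightarrow> _) \<in> past_space \<rightarrow>\<^sub>M borel"
  by (rule measurable_into_fun_borel[OF assms]) (simp add: past_extension_def)

lemma funpow_shift: "(shift ^^ j) x k = x (k + int j)"
  by (induction j arbitrary: x k) (auto simp: shift_def algebra_simps)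

lemma hoelder_bounds:
  fixes \<xi> :: "(int \<Rightarrow> 'a::metric_space) \<Rightarrow> complex"
  assumes xi: "\<xi> \<in> hoelder_space \<alpha>" and R: "hoelder_norm \<alpha> \<xi> \<le> R"
  shows "cmod (\<xi> x) \<le> R"
    and "seq_dist x y \<le> (1/2) ^ k \<Longrightarrow> cmod (\<xi> x - \<xi> y) \<le> R * (2 powr (- \<alpha>)) ^ k"
proof -
  have bd: "bounded (range \<xi>)" and bv: "bdd_above (range (\<lambda>k::nat. 2 powr (\<alpha> * real k) * variation \<xi> k))"
    using xi by (auto simp: hoelder_space_def)
  obtain B where B: "\<And>x. cmod (\<xi> x) \<le> B" using bd unfolding bounded_iff by auto
  have sup: "cmod (\<xi> x) \<le> sup_norm \<xi>" for x
    unfolding sup_norm_def using B by (intro cSUP_upper bdd_aboveI[of _ B]) auto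
  have var: "cmod (\<xi> x - \<xi> y) \<le> variation \<xi> k" if "seq_dist x y \<le> (1/2) ^ k" for x y k
  proof -
    have "cmod (\<xi> x - \<xi> y) \<le> 2 * B" for x y using norm_triangle_ineq4[of "\<xi> x" "\<xi> y"] B[of x] B[of y] by linarith
    then have "bdd_above ((\<lambda>(x, y). cmod (\<xi> x - \<xi> y)) ` {(x, y). seq_dist x y \<le> (1/2) ^ k})"
      by (intro bdd_aboveI[of _ "2 * B"]) auto
    from cSUP_upper[OF _ this, of "(x, y)"] that show ?thesis by (simp add: variation_def)
  qed
  have semi: "2 powr (\<alpha> * real k) * variation \<xi> k \<le> hoelder_seminorm \<alpha> \<xi>" for k
    unfolding hoelder_seminorm_def by (rule cSUP_upper[OF _ bv]) simp
  have "0 \<le> variation \<xi> 0" using var[of x x 0] by (simp add: seq_dist_def)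
  then have "0 \<le> hoelder_seminorm \<alpha> \<xi>" using semi[of 0] by simp
  moreover have "0 \<le> sup_norm \<xi>" using sup[of x] norm_ge_zero order_trans by blast
  ultimately have le: "sup_norm \<xi> \<le> R" "hoelder_seminorm \<alpha> \<xi> \<le> R" using R by (auto simp: hoelder_norm_def)
  show "cmod (\<xi> x) \<le> R" using sup[of x] le by linarith
  assume d: "seq_dist x y \<le> (1/2) ^ k"
  have "cmod (\<xi> x - \<xi> y) = 2 powr (\<alpha> * real k) * cmod (\<xi> x - \<xi> y) * (2 powr (- \<alpha>)) ^ k"
    by (simp add: powr_minus powr_realpow[symmetric] powr_powr power_inverse)
  also have "2 powr (\<alpha> * real k) * cmod (\<xi> x - \<xi> y) \<le> R"
    by (rule order_trans[OF mult_left_mono[OF var[OF d]] order_trans[OF semi le(2)]]) simp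
  finally show "cmod (\<xi> x - \<xi> y) \<le> R * (2 powr (- \<alpha>)) ^ k" by (simp add: mult_right_mono)
qed

lemma seq_dist_past_extension_le:
  assumes "\<And>i. i \<le> m \<Longrightarrow> u i = v i"
  shows "seq_dist (past_extension u) (past_extension v) \<le> (1/2) ^ m"
proof (cases "past_extension u = past_extension v")
  case False
  let ?N = "{nat \<bar>k\<bar> |k. past_extension u k \<noteq> past_extension v k}"
  have ne: "?N \<noteq> {}" using False by auto
  have "m \<le> Inf ?N"
  proof (rule cInf_greatest[OF ne])
    fix n assume "n \<in> ?N"
    then obtain k where k: "n = nat \<bar>k\<bar>" "u (nat (- k)) \<noteq> v (nat (- k))" by (auto simp: past_extension_def)
    then have "\<not> nat (- k) \<le> m" using assms by metis
    then show "m \<le> n" using k(1) by auto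
  qed
  then have "(1/2 :: real) ^ Inf ?N \<le> (1/2) ^ m" by (intro power_decreasing) auto
  then show ?thesis using False by (simp add: seq_dist_def)
qed (simp add: seq_dist_def)

section \<open>Large deviations\<close>

lemma observable_at_past:
  assumes "future_independent \<xi>"
  shows "\<xi> (past_extension (past_at (int j) x)) = \<xi> ((shift ^^ j) x)"
proof -
  have "past_extension (past_at (int j) x) k = (shift ^^ j) x k" if "k \<le> 0" for k
    using that by (simp add: past_extension_def past_at_def funpow_shift add.commute)
  then show ?thesis using assms unfolding future_independent_def by blast
qed

lemma funpow_tail_past_at:
  "((\<lambda>u k. u (Suc k)) ^^ i) (past_at m x) = past_at (m - int i) x"
  by (induction i) (auto simp: past_at_def fun_eq_iff algebra_simps)

lemma Re_of_real_mult: "Re (of_real r * z) = r * Re z"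
  by simp

text \<open>The first \<open>n\<close> terms of the orbit are read off the single past seen at time \<open>n - 1\<close>, whose tails
  are the pasts seen at earlier times. Its law is stationary for \<open>extend K\<close>, and the oscillation
  estimate bounds the distance of \<open>Q\<^sup>j f\<close> from its mean by \<open>\<delta> j\<close>, with total at most \<open>M - 1\<close>. The
  unit vector \<open>s\<close> selects the direction in the complex plane along which the deviation is measured.\<close>

lemma one_sided_deviation:
  fixes K :: "'a::metric_space \<Rightarrow> 'a measure" and \<xi> :: "(int \<Rightarrow> 'a) \<Rightarrow> complex"
  assumes cpt: "compact (UNIV :: 'a set)" and \<alpha>: "0 < \<alpha>"
    and contr: "\<And>g B x y i. g \<in> borel_measurable borel \<Longrightarrow> (\<And>z. \<bar>g z\<bar> \<le> B) \<Longrightarrow>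
      \<bar>(markov_op K ^^ i) g x - (markov_op K ^^ i) g y\<bar> \<le> A * B * \<rho> ^ i"
    and A: "0 < A" and \<rho>: "0 \<le> \<rho>" "\<rho> < 1"
    and sys: "markov_system K \<mu>" and law: "markov_chain_law K \<mu> P"
    and xi: "\<xi> \<in> hoelder_space_past \<alpha>" "hoelder_norm \<alpha> \<xi> \<le> R"
    and s: "cmod s = 1" and eps: "0 < \<epsilon>" "\<epsilon> < 1"
  defines "M \<equiv> 1 + (2 * R + A * R) * (2 / (1 - max (2 powr (- \<alpha>)) \<rho>))"
  shows "measure P {x. Re (s * ((\<Sum>j<n. \<xi> ((shift ^^ j) x)) - of_nat n * (\<integral>x. \<xi> x \<partial>P))) > real n * \<epsilon>}
      \<le> exp 3 * exp (- (1 / (2 * M\<^sup>2)) * \<epsilon>\<^sup>2 * real n)"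
proof -
  have K: "markov_kernel K" using sys by (simp add: markov_system_def)
  have P: "prob_space P" "sets P = sets borel" using law by (auto simp: markov_chain_law_def)
  interpret P: prob_space P by fact
  have spP: "space P = UNIV" using sets_eq_imp_space_eq[OF P(2)] by simp
  have fi: "future_independent \<xi>" and hs: "\<xi> \<in> hoelder_space \<alpha>" and xm: "\<xi> \<in> borel_measurable borel"
    using xi by (auto simp: hoelder_space_past_def hoelder_space_def)
  note xb = hoelder_bounds(1)[OF hs xi(2)]
  have R: "0 \<le> R" using xb[of undefined] norm_ge_zero order_trans by blast
  define \<theta> where "\<theta> = max (2 powr (- \<alpha>)) \<rho>"
  have \<theta>: "0 \<le> \<theta>" "\<theta> < 1" using \<alpha> \<rho> by (auto simp: \<theta>_def powr_less_one)
  define f where "f u = Re (s * \<xi> (past_extension u))" for u :: "nat \<Rightarrow> 'a"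
  have f: "f \<in> borel_measurable past_space"
  proof -
    have "(\<lambda>u. \<xi> (past_extension u)) \<in> borel_measurable past_space"
      by (rule measurable_compose[OF past_extension_measurable[OF cpt] xm])
    then show ?thesis unfolding f_def by measurable
  qed
  have fb: "\<bar>f u\<bar> \<le> R" for u
    using abs_Re_le_cmod[of "s * \<xi> (past_extension u)"] xb[of "past_extension u"] s
    by (simp add: f_def norm_mult)
  have fosc: "\<bar>f u - f v\<bar> \<le> R * (2 powr (- \<alpha>)) ^ m" if uv: "\<And>i. i \<le> m \<Longrightarrow> u i = v i" for m u v
  proof -
    have "\<bar>f u - f v\<bar> \<le> cmod (s * (\<xi> (past_extension u) - \<xi> (past_extension v)))"
      using abs_Re_le_cmod[of "s * (\<xi> (past_extension u) - \<xi> (past_extension v))"]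
      by (simp add: f_def right_diff_distrib)
    also have "\<dots> = cmod (\<xi> (past_extension u) - \<xi> (past_extension v))" using s by (simp add: norm_mult)
    also have "\<dots> \<le> R * (2 powr (- \<alpha>)) ^ m"
      by (rule hoelder_bounds(2)[OF hs xi(2) seq_dist_past_extension_le[OF uv]])
    finally show ?thesis .
  qed
  define \<nu> where "\<nu> = distr P past_space (past_at (int n - 1))"
  have nu: "sets \<nu> = sets past_space" "prob_space \<nu>" "\<nu> \<bind> extend K = \<nu>"
    unfolding \<nu>_def by (simp_all add: past_law_prob[OF law] past_law_stationary[OF sys law])
  interpret prob_space \<nu> by fact
  have meas_past: "past_at m \<in> P \<rightarrow>\<^sub>M past_space" for m
    using past_at_measurable by (simp add: measurable_cong_sets[OF P(2) refl])
  define c where "c = (\<integral>u. f u \<partial>\<nu>)"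
  have c: "c = Re (s * (\<integral>x. \<xi> x \<partial>P))"
  proof -
    have "c = (\<integral>u. f u \<partial>distr P past_space (past_at (int 0)))"
      unfolding c_def \<nu>_def past_law_shift_invariant[OF sys law, of "int n - 1" "int 0"] ..
    also have "\<dots> = (\<integral>x. f (past_at (int 0) x) \<partial>P)" by (rule integral_distr[OF meas_past f])
    also have "\<dots> = (\<integral>x. Re (s * \<xi> x) \<partial>P)"
      unfolding f_def observable_at_past[OF fi] by simp
    also have "\<dots> = Re (\<integral>x. s * \<xi> x \<partial>P)"
    proof (rule integral_Re)
      show "integrable P (\<lambda>x. s * \<xi> x)"
        using xm xb s
        by (intro P.integrable_const_bound[of _ R]) (auto simp: norm_mult measurable_cong_sets[OF P(2) refl])
    qed
    finally show ?thesis by simp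
  qed
  let ?Q = "markov_op (extend K)"
  note L = extend_kernel[OF K] space_past_space
  define \<delta> where "\<delta> j = (2 * R + A * R) * \<theta> ^ (j div 2)" for j
  have osc: "\<bar>(?Q ^^ j) f u - (?Q ^^ j) f v\<bar> \<le> \<delta> j" for j u v
    unfolding \<delta>_def
    by (rule markov_op_extend_oscillation[OF K contr f fb fosc A R])
       (use \<theta> \<rho> in \<open>auto simp: \<theta>_def\<close>)
  have delta1: "\<bar>(?Q ^^ j) f u - c\<bar> \<le> \<delta> j" for j u
  proof -
    have "\<bar>(\<integral>v. (?Q ^^ j) f u \<partial>\<nu>) - (\<integral>v. (?Q ^^ j) f v \<partial>\<nu>)\<bar> \<le> \<delta> j"
      by (rule abs_integral_diff_le[OF _ _ _ _ osc])
         (use markov_op_funpow_measurable_bounded[OF L f fb] in \<open>auto simp: measurable_cong_sets[OF nu(1) refl]\<close>)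
    then show ?thesis
      unfolding integral_markov_op_stationary[OF L nu(2,1,3) f fb] c_def by (simp add: prob_space)
  qed
  have Anonneg: "0 \<le> 2 * R + A * R" using R A by simp
  have sum_delta: "(\<Sum>j<N. \<delta> j) \<le> M - 1" for N
    using mult_left_mono[OF sum_power_div2_le[OF \<theta>, of N] Anonneg]
    by (simp add: \<delta>_def M_def \<theta>_def sum_distrib_left)
  have sum_delta': "(\<Sum>j<N. \<delta> j) \<le> M" for N
    using sum_delta[of N] by linarith
  have "summable \<delta>"
    by (rule summableI_nonneg_bounded[OF _ sum_delta]) (use Anonneg \<theta> in \<open>simp add: \<delta>_def\<close>)
  then have delta0: "\<delta> \<longlonglongrightarrow> 0" by (rule summable_LIMSEQ_zero)
  have M: "1 \<le> M" using sum_delta[of 0] by simp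
  let ?D = "\<lambda>(u :: nat \<Rightarrow> 'a) k. u (Suc k)"
  have D: "?D \<in> past_space \<rightarrow>\<^sub>M past_space"
    by (rule measurable_into_past_space) simp
  have conc: "measure \<nu> {u. (\<Sum>i<n. f ((?D ^^ i) u) - c) > real n * \<epsilon>}
      \<le> exp 3 * exp (- (1 / (2 * M\<^sup>2)) * \<epsilon>\<^sup>2 * real n)"
    by (rule birkhoff_sum_deviation[OF L nu D AE_extend_tail[OF K] f fb delta1 sum_delta' delta0 M eps])
  have sum_eq: "(\<Sum>i<n. f ((?D ^^ i) (past_at (int n - 1) x)) - c)
      = Re (s * ((\<Sum>j<n. \<xi> ((shift ^^ j) x)) - of_nat n * (\<integral>x. \<xi> x \<partial>P)))" for x
  proof -
    have "(\<Sum>i<n. f ((?D ^^ i) (past_at (int n - 1) x)) - c) = (\<Sum>i<n. Re (s * \<xi> ((shift ^^ (n - Suc i)) x)) - c)"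
    proof (intro sum.cong refl)
      fix i assume "i \<in> {..<n}"
      then have e: "int n - 1 - int i = int (n - Suc i)" by auto
      show "f ((?D ^^ i) (past_at (int n - 1) x)) - c = Re (s * \<xi> ((shift ^^ (n - Suc i)) x)) - c"
        unfolding funpow_tail_past_at e f_def observable_at_past[OF fi] ..
    qed
    also have "\<dots> = (\<Sum>j<n. Re (s * \<xi> ((shift ^^ j) x)) - c)"
      by (rule sum.nat_diff_reindex)
    also have "\<dots> = Re (s * ((\<Sum>j<n. \<xi> ((shift ^^ j) x)) - of_nat n * (\<integral>x. \<xi> x \<partial>P)))"
    proof -
      have "s * ((\<Sum>j<n. \<xi> ((shift ^^ j) x)) - of_nat n * (\<integral>x. \<xi> x \<partial>P))
          = (\<Sum>j<n. s * \<xi> ((shift ^^ j) x)) - of_real (real n) * (s * (\<integral>x. \<xi> x \<partial>P))"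
        unfolding right_diff_distrib sum_distrib_left by (simp add: mult.left_commute)
      then show ?thesis
        by (simp only: minus_complex.sel Re_sum Re_of_real_mult c sum_subtractf sum_constant card_lessThan)
    qed
    finally show ?thesis .
  qed
  let ?E = "{u. (\<Sum>i<n. f ((?D ^^ i) u) - c) > real n * \<epsilon>}"
  have "{u \<in> space past_space. (\<Sum>i<n. f ((?D ^^ i) u) - c) > real n * \<epsilon>} \<in> sets past_space"
  proof -
    have [measurable]: "(\<lambda>u. f ((?D ^^ i) u)) \<in> borel_measurable past_space" for i
      by (rule measurable_compose[OF measurable_compose_n[OF D] f])
    show ?thesis by measurable
  qed
  then have "?E \<in> sets past_space" by (simp add: space_past_space)
  then have "measure \<nu> ?E = measure P {x. past_at (int n - 1) x \<in> ?E}"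
    unfolding \<nu>_def by (subst measure_distr[OF meas_past]) (simp_all add: spP vimage_def)
  then show ?thesis using conc by (simp add: sum_eq)
qed

lemma cmod_gt_imp_Re_rotation_gt:
  assumes "cmod z > \<epsilon>"
  shows "\<exists>s\<in>{1, -1, \<i>, -\<i>}. Re (s * z) > \<epsilon> / 2"
  using assms cmod_le[of z] by (auto simp: abs_if split: if_splits)

theorem theorem1p2:
  fixes K :: "'a::metric_space \<Rightarrow> 'a measure" and \<alpha> :: real
  assumes "compact (UNIV :: 'a set)"
    and "markov_kernel K"
    and "0 < \<alpha>" and "\<alpha> \<le> 1"
  shows "\<forall>R::real. \<exists>C>0. \<exists>k>0. \<exists>\<epsilon>\<^sub>0>0.
    \<forall>\<mu> P. markov_system K \<mu> \<longrightarrow> strongly_mixing K \<mu> \<longrightarrow> markov_chain_law K \<mu> P \<longrightarrow>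
      (\<forall>\<xi>\<in>hoelder_space_past \<alpha>. hoelder_norm \<alpha> \<xi> \<le> R \<longrightarrow>
        (\<forall>(\<epsilon>::real) (n::nat). 0 < \<epsilon> \<longrightarrow> \<epsilon> < \<epsilon>\<^sub>0 \<longrightarrow>
          measure P {x. cmod (1 / of_nat n * (\<Sum>j<n. \<xi> ((shift ^^ j) x)) - (\<integral>x. \<xi> x \<partial>P)) > \<epsilon>}
            \<le> C * exp (- k * \<epsilon>\<^sup>2 * real n)))"
proof
  fix R :: real
  show "\<exists>C>0. \<exists>k>0. \<exists>\<epsilon>\<^sub>0>0.
    \<forall>\<mu> P. markov_system K \<mu> \<longrightarrow> strongly_mixing K \<mu> \<longrightarrow> markov_chain_law K \<mu> P \<longrightarrow>
      (\<forall>\<xi>\<in>hoelder_space_past \<alpha>. hoelder_norm \<alpha> \<xi> \<le> R \<longrightarrow>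
        (\<forall>(\<epsilon>::real) (n::nat). 0 < \<epsilon> \<longrightarrow> \<epsilon> < \<epsilon>\<^sub>0 \<longrightarrow>
          measure P {x. cmod (1 / of_nat n * (\<Sum>j<n. \<xi> ((shift ^^ j) x)) - (\<integral>x. \<xi> x \<partial>P)) > \<epsilon>}
            \<le> C * exp (- k * \<epsilon>\<^sup>2 * real n)))"
  proof (cases "\<exists>\<mu>. strongly_mixing K \<mu>")
    case False
    then show ?thesis by (meson zero_less_one)
  next
    \<comment> \<open>the constants must be fixed before \<open>\<mu>\<close> is, and one mixing measure provides them\<close>
    case True
    then obtain \<mu>\<^sub>0 where "strongly_mixing K \<mu>\<^sub>0" by blast
    from strongly_mixing_contracts[OF assms(2) this] obtain A \<rho> where A: "0 < A" and \<rho>: "0 < \<rho>" "\<rho> < 1"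
      and contr: "\<And>g B x y i. g \<in> borel_measurable borel \<Longrightarrow> (\<And>z. \<bar>g z\<bar> \<le> B) \<Longrightarrow>
        \<bar>(markov_op K ^^ i) g x - (markov_op K ^^ i) g y\<bar> \<le> A * B * \<rho> ^ i"
      by blast
    define M where "M = 1 + (2 * \<bar>R\<bar> + A * \<bar>R\<bar>) * (2 / (1 - max (2 powr (- \<alpha>)) \<rho>))"
    have "M > 0"
    proof -
      have "max (2 powr (- \<alpha>)) \<rho> < 1" using \<rho> assms(3) by (simp add: powr_less_one)
      then show ?thesis unfolding M_def using A by (intro add_pos_nonneg mult_nonneg_nonneg) auto
    qed
    show ?thesis
    proof (intro exI conjI allI impI ballI)
      show "0 < 4 * exp (3::real)" by simp
      show "0 < 1 / (8 * M\<^sup>2)" using \<open>M > 0\<close> by simp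
      show "0 < (1::real)" by simp
      fix \<mu> P and \<xi> :: "(int \<Rightarrow> 'a) \<Rightarrow> complex" and \<epsilon> :: real and n :: nat
      assume sys: "markov_system K \<mu>" and law: "markov_chain_law K \<mu> P"
        and xi: "\<xi> \<in> hoelder_space_past \<alpha>" "hoelder_norm \<alpha> \<xi> \<le> R" and eps: "0 < \<epsilon>" "\<epsilon> < 1"
      interpret P: prob_space P using law by (simp add: markov_chain_law_def)
      have P: "sets P = sets borel" using law by (simp add: markov_chain_law_def)
      have spP: "space P = UNIV" using sets_eq_imp_space_eq[OF P] by simp
      let ?dev = "{x. cmod (1 / of_nat n * (\<Sum>j<n. \<xi> ((shift ^^ j) x)) - (\<integral>x. \<xi> x \<partial>P)) > \<epsilon>}"
      show "measure P ?dev \<le> 4 * exp 3 * exp (- (1 / (8 * M\<^sup>2)) * \<epsilon>\<^sup>2 * real n)"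
      proof (cases "n = 0")
        case True
        \<comment> \<open>the average is \<open>0\<close> here and may well deviate, but the bound exceeds \<open>1\<close>\<close>
        have "1 \<le> exp (3::real)" by simp
        then have "1 \<le> 4 * exp (3::real)" by linarith
        then show ?thesis by (intro order_trans[OF P.prob_le_1]) (simp add: True)
      next
        case False
        define E where "E s = {x. Re (s * ((\<Sum>j<n. \<xi> ((shift ^^ j) x)) - of_nat n * (\<integral>x. \<xi> x \<partial>P))) > real n * (\<epsilon> / 2)}" for s
        have meas: "E s \<in> sets P" for s
        proof -
          have "shift \<in> borel \<rightarrow>\<^sub>M (borel :: (int \<Rightarrow> 'a) measure)"
            unfolding shift_def
            by (intro borel_measurable_continuous_onI continuous_on_coordinatewise_then_product) simp
          from measurable_compose[OF measurable_compose_n[OF this], of \<xi> borel]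
          have [measurable]: "(\<lambda>x. \<xi> ((shift ^^ j) x)) \<in> borel_measurable borel" for j
            using xi by (simp add: hoelder_space_past_def hoelder_space_def)
          have "{x \<in> space borel. Re (s * ((\<Sum>j<n. \<xi> ((shift ^^ j) x)) - of_nat n * (\<integral>x. \<xi> x \<partial>P))) > real n * (\<epsilon> / 2)} \<in> sets borel"
            by measurable
          then show ?thesis by (simp add: E_def P)
        qed
        \<comment> \<open>replacing \<open>\<epsilon>\<close> by \<open>\<epsilon> / 2\<close> turns \<open>1 / (2 * M\<^sup>2)\<close> into \<open>1 / (8 * M\<^sup>2)\<close>\<close>
        have bound: "measure P (E s) \<le> exp 3 * exp (- (1 / (8 * M\<^sup>2)) * \<epsilon>\<^sup>2 * real n)" if "cmod s = 1" for s
        proof -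
          have "hoelder_norm \<alpha> \<xi> \<le> \<bar>R\<bar>" using xi by simp
          from one_sided_deviation[OF assms(1,3) contr A _ _ sys law xi(1) this that, of "\<epsilon> / 2" n] eps \<rho>
          show ?thesis unfolding E_def M_def[symmetric] by (simp add: power_divide)
        qed
        have "?dev \<subseteq> E 1 \<union> E (-1) \<union> E \<i> \<union> E (-\<i>)"
        proof
          fix x assume "x \<in> ?dev"
          then obtain s where s: "s \<in> {1, -1, \<i>, -\<i>}"
            and "Re (s * (1 / of_nat n * (\<Sum>j<n. \<xi> ((shift ^^ j) x)) - (\<integral>x. \<xi> x \<partial>P))) > \<epsilon> / 2"
            using cmod_gt_imp_Re_rotation_gt by blast
          then have "real n * (\<epsilon> / 2) < real n * Re (s * (1 / of_nat n * (\<Sum>j<n. \<xi> ((shift ^^ j) x)) - (\<integral>x. \<xi> x \<partial>P)))"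
            using False by (intro mult_strict_left_mono) auto
          also have "\<dots> = Re (of_real (real n) * (s * (1 / of_nat n * (\<Sum>j<n. \<xi> ((shift ^^ j) x)) - (\<integral>x. \<xi> x \<partial>P))))"
            by (simp only: Re_of_real_mult)
          also have "of_real (real n) * (s * (1 / of_nat n * (\<Sum>j<n. \<xi> ((shift ^^ j) x)) - (\<integral>x. \<xi> x \<partial>P)))
              = s * ((\<Sum>j<n. \<xi> ((shift ^^ j) x)) - of_nat n * (\<integral>x. \<xi> x \<partial>P))"
            using False by (simp add: field_simps)
          finally have "x \<in> E s" by (simp add: E_def)
          then show "x \<in> E 1 \<union> E (-1) \<union> E \<i> \<union> E (-\<i>)" using s by auto
        qed
        then have "measure P ?dev \<le> measure P (E 1 \<union> E (-1) \<union> E \<i> \<union> E (-\<i>))"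
          by (rule P.finite_measure_mono) (use meas in auto)
        also have "\<dots> \<le> measure P (E 1) + measure P (E (-1)) + measure P (E \<i>) + measure P (E (-\<i>))"
          by (intro order_trans[OF measure_Un_le] add_mono order_refl) (use meas in auto)
        also have "\<dots> \<le> 4 * exp 3 * exp (- (1 / (8 * M\<^sup>2)) * \<epsilon>\<^sup>2 * real n)"
          using bound[of 1] bound[of "-1"] bound[of \<i>] bound[of "-\<i>"] by simp
        finally show ?thesis .
      qed
    qed
  qed
qed

end
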